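(* Let $G$ be a triangle-free planar graph and $\pi:E(G)\to\mathbb{F}_2$ a 2-edge-coloring of $G$. Then $(G,\pi)$ admits a $\binom{10}{3}$-inversion.
   Context: Graphs are finite and simple. For a positive integer $t$, a $t$-inversion of a 2-edge-colored graph $(G,\pi)$ is an assignment of a vector $\mathbf{u}\in\mathbb{F}_2^t$ to each vertex $u\in V(G)$ such that $\pi(uv)=\mathbf{u}\cdot\mathbf{v}$ (standard dot product over $\mathbb{F}_2$) for every edge $uv\in E(G)$. For $0\le k\le d$, a $\binom{d}{k}$-vector is a vector of $\mathbb{F}_2^d$ with exactly $k$ non-zero entries, and a $\binom{d}{k}$-inversion is a $d$-inversion in which the vector assigned to each vertex is a $\binom{d}{k}$-vector. *)

theory Defs
  imports
    "HOL-Analysis.Analysis"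
    "HOL-Library.Z2"
    "Jordan_Normal_Form.Matrix"
begin

definition simple_graph :: "'a set \<Rightarrow> 'a set set \<Rightarrow> bool" where
  "simple_graph V E \<longleftrightarrow> finite V \<and> (\<forall>e\<in>E. e \<subseteq> V \<and> card e = 2)"

(* Edges are two-element sets, so u, v, w are automatically distinct. *)
definition triangle_free :: "'a set set \<Rightarrow> bool" where
  "triangle_free E \<longleftrightarrow> \<not> (\<exists>u v w. {u, v} \<in> E \<and> {v, w} \<in> E \<and> {u, w} \<in> E)"

(* Drawing in the plane (the type complex): vertex v is the point p v, edge e is the arc
   (injective path) g e joining its two ends.  An arc meets no vertex other than its ends, and
   two different arcs meet only in the points of the common end vertices of the two edges. *)
definition plane_drawing ::
  "'a set \<Rightarrow> 'a set set \<Rightarrow> ('a \<Rightarrow> complex) \<Rightarrow> ('a set \<Rightarrow> real \<Rightarrow> complex) \<Rightarrow> bool" where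
  "plane_drawing V E p g \<longleftrightarrow>
     inj_on p V \<and>
     (\<forall>e\<in>E. arc (g e) \<and> {pathstart (g e), pathfinish (g e)} = p ` e) \<and>
     (\<forall>e\<in>E. path_image (g e) \<inter> p ` V = p ` e) \<and>
     (\<forall>e\<in>E. \<forall>e'\<in>E. e \<noteq> e' \<longrightarrow> path_image (g e) \<inter> path_image (g e') = p ` (e \<inter> e'))"

definition planar_graph :: "'a set \<Rightarrow> 'a set set \<Rightarrow> bool" where
  "planar_graph V E \<longleftrightarrow> (\<exists>p g. plane_drawing V E p g)"

(* The type bit is the field with two elements.  A 2-edge-coloring is a function c on edges;
   its values outside E are irrelevant, as are the values of f outside V. *)
definition is_inversion ::
  "nat \<Rightarrow> 'a set \<Rightarrow> 'a set set \<Rightarrow> ('a set \<Rightarrow> bit) \<Rightarrow> ('a \<Rightarrow> bit vec) \<Rightarrow> bool" where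
  "is_inversion t V E c f \<longleftrightarrow>
     (\<forall>u\<in>V. f u \<in> carrier_vec t) \<and>
     (\<forall>u v. {u, v} \<in> E \<longrightarrow> c {u, v} = scalar_prod (f u) (f v))"

definition binom_vectors :: "nat \<Rightarrow> nat \<Rightarrow> bit vec set" where
  "binom_vectors d k = {x \<in> carrier_vec d. card {i. i < d \<and> vec_index x i \<noteq> 0} = k}"

definition is_binom_inversion ::
  "nat \<Rightarrow> nat \<Rightarrow> 'a set \<Rightarrow> 'a set set \<Rightarrow> ('a set \<Rightarrow> bit) \<Rightarrow> ('a \<Rightarrow> bit vec) \<Rightarrow> bool" where
  "is_binom_inversion d k V E c f \<longleftrightarrow>
     is_inversion d V E c f \<and> (\<forall>u\<in>V. f u \<in> binom_vectors d k)"

end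

theory Submission
  imports Defs
begin

text \<open>Distinctness is the obstacle: two neighbours of \<open>v\<close> with the same vector
  but different prescribed products would leave no vector for \<open>v\<close>. So the vectors of
  the neighbours must be kept apart before \<open>v\<close> is coloured, and a vertex of small
  degree is a good choice only if it has few conflicts too. The constants fit narrowly: against 7
  solutions (three neighbours) or 24 (fewer) the discharging allows at most 6 or 17 conflicts. The
  solutions are counted by character sums over the 120 vectors of weight 3.

  Many eliminated vertices may share one pair of neighbours. They cause a single conflict but could
  create many faces of length 4, so only one of them is kept. It adds one vertex and two edges,
  hence cancels in \<open>8 n - 4 e\<close>, the quantity that governs the discharging when every
  face has length at least 4. With one vertex per pair, a face that passes between two of them at
  \<open>v\<close> has at least five vertices, and this gain bounds the conflicts that come from
  pairs.\<close>

text \<open>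
  Colour the vertices in the reverse of an elimination order. Let \<open>M\<close> be the set of vertices that are not
  yet eliminated; every eliminated vertex has at most three neighbours in \<open>M\<close>. The colouring of \<open>M\<close> is kept
  injective on the neighbourhood in \<open>M\<close> of each eliminated vertex. Three distinct vectors of weight 3 and
  any prescribed products admit at least 7 solutions of weight 3 (fewer vectors at least 24), so a vertex
  \<open>v\<close> can be coloured after \<open>M - {v}\<close> if it has at most three neighbours in \<open>M\<close> and few conflicts, that is,
  few vertices that share an eliminated neighbour with it.

  Such a \<open>v\<close> exists by discharging, applied to the graph on \<open>M\<close>, the eliminated vertices with three
  neighbours in \<open>M\<close>, and one eliminated vertex for each pair that is the neighbourhood of one. If \<open>v\<close> has many
  conflicts, then it lies between two vertices of the last kind on many faces, and a face on which this
  happens \<open>t\<close> times has length at least \<open>4 + t / 2\<close>.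

  In place of Euler's formula this needs only a family of at least \<open>e - n + 1\<close> cycles that covers each edge
  at most twice. It is obtained by cutting a disc along ears with the theta-curve theorem; an inversion
  centred inside a cycle with empty inside moves the whole graph into the disc bounded by that cycle.
\<close>

section \<open>Triples with prescribed intersection parities\<close>

definition elem_sym :: "nat \<Rightarrow> 'a set \<Rightarrow> ('a \<Rightarrow> int) \<Rightarrow> int" where
  "elem_sym k S x = (\<Sum>c | c \<subseteq> S \<and> card c = k. \<Prod>i\<in>c. x i)"

lemma elem_sym_0: "finite S \<Longrightarrow> elem_sym 0 S x = 1"
proof -
  assume "finite S"
  then have "c = {}" if "c \<subseteq> S" "card c = 0" for c using that finite_subset[OF that(1)] by simp
  then have "{c. c \<subseteq> S \<and> card c = 0} = {{}}" by auto
  then show ?thesis by (simp add: elem_sym_def)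
qed

lemma elem_sym_empty: "elem_sym (Suc k) {} x = 0"
  by (auto simp: elem_sym_def intro!: sum.neutral)

lemma elem_sym_insert:
  assumes "finite S" "i \<notin> S"
  shows "elem_sym (Suc k) (insert i S) x = elem_sym (Suc k) S x + x i * elem_sym k S x"
proof -
  let ?C = "\<lambda>k. {c. c \<subseteq> S \<and> card c = k}"
  have fin: "finite c" if "c \<subseteq> S" for c using assms(1) that finite_subset by auto
  have "{c. c \<subseteq> insert i S \<and> card c = Suc k} = ?C (Suc k) \<union> insert i ` ?C k" (is "?L = ?R")
  proof (intro subset_antisym subsetI)
    fix c assume c: "c \<in> ?L"
    show "c \<in> ?R"
    proof (cases "i \<in> c")
      case True
      have "c - {i} \<subseteq> S" "card (c - {i}) = k" "c = insert i (c - {i})" using c True by auto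
      then show ?thesis by blast
    qed (use c in auto)
  next
    fix c assume "c \<in> ?R"
    then show "c \<in> ?L" using fin assms(2) by (auto simp: card_insert_if)
  qed
  then have "elem_sym (Suc k) (insert i S) x = (\<Sum>c\<in>?C (Suc k) \<union> insert i ` ?C k. \<Prod>j\<in>c. x j)"
    by (simp add: elem_sym_def)
  also have "\<dots> = elem_sym (Suc k) S x + (\<Sum>c\<in>insert i ` ?C k. \<Prod>j\<in>c. x j)"
    unfolding elem_sym_def using assms by (subst sum.union_disjoint) auto
  also have "(\<Sum>c\<in>insert i ` ?C k. \<Prod>j\<in>c. x j) = (\<Sum>c\<in>?C k. \<Prod>j\<in>insert i c. x j)"
    using assms(2) by (subst sum.reindex) (auto simp: inj_on_def)
  also have "\<dots> = (\<Sum>c\<in>?C k. x i * (\<Prod>j\<in>c. x j))"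
    using assms(2) fin by (intro sum.cong prod.insert) auto
  finally show ?thesis by (simp add: elem_sym_def sum_distrib_left)
qed

text \<open>Since \<open>x\<close> is a sign, its higher powers disappear. This is the step of the
  induction in \<open>elem_sym_3\<close>: the sign \<open>x\<close> joins \<open>n\<close> signs
  with sum \<open>p\<close>.\<close>

lemma elem_sym_step:
  fixes x p n e1 e2 e3 :: int
  assumes "x * x = 1" "2 * e2 = p ^ 2 - n" "6 * e3 = p ^ 3 - (3 * n - 2) * p"
  shows "2 * (e2 + x * p) = (x + p) ^ 2 - (n + 1)"
    "6 * (e3 + x * e2) = (x + p) ^ 3 - (3 * (n + 1) - 2) * (x + p)"
proof -
  have x: "x = 1 \<or> x = - 1" using assms(1) by (metis square_eq_1_iff)
  show "2 * (e2 + x * p) = (x + p) ^ 2 - (n + 1)"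
    using assms x by (auto simp: power2_eq_square algebra_simps)
  have "6 * (x * e2) = 3 * x * (2 * e2)" by simp
  then show "6 * (e3 + x * e2) = (x + p) ^ 3 - (3 * (n + 1) - 2) * (x + p)"
    unfolding assms(2) using assms(3) x by (auto simp: power2_eq_square power3_eq_cube algebra_simps)
qed

text \<open>Newton's identity \<open>6 e3 = p1^3 - 3 p1 p2 + 2 p3\<close>: for signs the power sums
  are \<open>p2 = card S\<close> and \<open>p3 = p1\<close>. The induction carries \<open>e2\<close>
  along because the recursion for \<open>e3\<close> refers to it.\<close>

lemma elem_sym_3:
  assumes "finite S" "\<And>i. x i * x i = 1"
  shows "6 * elem_sym 3 S x = (\<Sum>i\<in>S. x i) ^ 3 - (3 * int (card S) - 2) * (\<Sum>i\<in>S. x i)"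
proof -
  have "elem_sym 1 S x = (\<Sum>i\<in>S. x i) \<and> 2 * elem_sym 2 S x = (\<Sum>i\<in>S. x i) ^ 2 - int (card S) \<and>
    6 * elem_sym 3 S x = (\<Sum>i\<in>S. x i) ^ 3 - (3 * int (card S) - 2) * (\<Sum>i\<in>S. x i)"
    using assms(1)
  proof (induction S)
    case empty
    then show ?case by (simp add: elem_sym_empty numeral_eq_Suc)
  next
    case (insert i S)
    let ?p = "\<Sum>i\<in>S. x i"
    have s: "elem_sym 1 (insert i S) x = elem_sym 1 S x + x i"
      "elem_sym 2 (insert i S) x = elem_sym 2 S x + x i * elem_sym 1 S x"
      "elem_sym 3 (insert i S) x = elem_sym 3 S x + x i * elem_sym 2 S x"
      using elem_sym_insert[OF insert.hyps, of 0] elem_sym_insert[OF insert.hyps, of 1]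
        elem_sym_insert[OF insert.hyps, of 2] elem_sym_0[OF insert.hyps(1)] by (simp_all add: numeral_eq_Suc)
    have x: "x i * x i = 1" by (rule assms(2))
    have e1: "elem_sym 1 S x = ?p" and e2: "2 * elem_sym 2 S x = ?p ^ 2 - int (card S)"
      and e3: "6 * elem_sym 3 S x = ?p ^ 3 - (3 * int (card S) - 2) * ?p" using insert.IH by auto
    have sum: "(\<Sum>i\<in>insert i S. x i) = x i + ?p" and card: "int (card (insert i S)) = int (card S) + 1"
      using insert.hyps by auto
    show ?case
      unfolding s sum card using elem_sym_step[OF x e2 e3] e1 by (simp add: add.commute)
  qed
  then show ?thesis by blast
qed

text \<open>A support stands for a vector of weight 3: the dot product of two vectors is the parity
  of the intersection of their supports.\<close>

definition triples :: "nat set set" where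
  "triples = {c. c \<subseteq> {..<10} \<and> card c = 3}"

lemma finite_triples [simp]: "finite triples"
  by (rule finite_subset[of _ "Pow {..<10}"]) (auto simp: triples_def)

lemma card_triples: "card triples = 120"
proof -
  have "card triples = card {..<10::nat} choose 3" unfolding triples_def by (rule n_subsets) simp
  also have "\<dots> = 120" by (simp add: numeral_eq_Suc)
  finally show ?thesis .
qed

section \<open>Sign vectors as characters, and their sums over all triples\<close>

definition sign_in :: "nat set \<Rightarrow> nat \<Rightarrow> int" where
  "sign_in A i = (if i \<in> A then - 1 else 1)"

lemma sign_in_sq: "sign_in A i * sign_in A i = 1"
  by (simp add: sign_in_def)

lemma sign_in_eq: "sign_in A i = 1 - 2 * of_bool (i \<in> A)"
  by (simp add: sign_in_def)

lemma prod_sign_in: "finite c \<Longrightarrow> (\<Prod>i\<in>c. sign_in A i) = (if odd (card (c \<inter> A)) then - 1 else 1)"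
  by (induction c rule: finite_induct) (auto simp: sign_in_def)

text \<open>The Krawtchouk polynomial of degree 3 for length 10, in the variable \<open>p = 10 - 2w\<close>, where
  \<open>w\<close> is the weight.\<close>

definition kraw :: "int \<Rightarrow> int" where
  "kraw p = (p ^ 3 - 28 * p) div 6"

text \<open>The 28 in \<open>kraw\<close> is \<open>3 * 10 - 2\<close> from
  \<open>elem_sym_3\<close>, and the same identity shows that the division by 6 is exact
  here.\<close>

lemma sum_triples:
  assumes "\<And>i. x i * x i = 1"
  shows "(\<Sum>c\<in>triples. \<Prod>i\<in>c. x i) = kraw (\<Sum>i<10. x i)"
proof -
  have "6 * (\<Sum>c\<in>triples. \<Prod>i\<in>c. x i) = (\<Sum>i<10. x i) ^ 3 - 28 * (\<Sum>i<10. x i)"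
    using elem_sym_3[of "{..<10}" x] assms by (simp add: elem_sym_def triples_def)
  then show ?thesis by (simp add: kraw_def)
qed

lemma sum_of_bool_mem: "A \<subseteq> {..<n} \<Longrightarrow> (\<Sum>i<n. of_bool (i \<in> A)) = int (card A)" for n :: nat
  by (simp add: Int_absorb1)

lemma sum_sign_in:
  assumes "A \<subseteq> {..<10}"
  shows "(\<Sum>i<10. sign_in A i) = 10 - 2 * int (card A)"
proof -
  have "(\<Sum>i<10. sign_in A i) = (\<Sum>i<10::nat. 1) - 2 * (\<Sum>i<10::nat. of_bool (i \<in> A))"
    unfolding sign_in_eq sum_distrib_left sum_subtractf by simp
  then show ?thesis unfolding sum_of_bool_mem[OF assms] by simp
qed

text \<open>The product of the two sign functions is that of the symmetric difference, so the sum is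
  10 minus twice its size.\<close>

lemma sum_sign_in2:
  assumes "A \<subseteq> {..<10}" "B \<subseteq> {..<10}"
  shows "(\<Sum>i<10. sign_in A i * sign_in B i) = 10 - 2 * int (card A) - 2 * int (card B) + 4 * int (card (A \<inter> B))"
proof -
  have "sign_in A i * sign_in B i = sign_in A i + sign_in B i - 1 + 4 * of_bool (i \<in> A \<inter> B)" for i
    by (simp add: sign_in_def)
  then have "(\<Sum>i<10. sign_in A i * sign_in B i) = (\<Sum>i<10. sign_in A i) + (\<Sum>i<10. sign_in B i) - (\<Sum>i<10::nat. 1)
      + 4 * (\<Sum>i<10::nat. of_bool (i \<in> A \<inter> B))"
    by (simp only: sum_distrib_left sum_subtractf sum.distrib)
  moreover have "A \<inter> B \<subseteq> {..<10}" using assms by auto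
  ultimately show ?thesis by (simp only: sum_sign_in[OF assms(1)] sum_sign_in[OF assms(2)] sum_of_bool_mem) simp
qed

lemma sum_sign_in3:
  assumes "A \<subseteq> {..<10}" "B \<subseteq> {..<10}" "C \<subseteq> {..<10}"
  shows "(\<Sum>i<10. sign_in A i * sign_in B i * sign_in C i) =
    10 - 2 * (int (card A) + int (card B) + int (card C))
    + 4 * (int (card (A \<inter> B)) + int (card (A \<inter> C)) + int (card (B \<inter> C))) - 8 * int (card (A \<inter> B \<inter> C))"
proof -
  have "sign_in A i * sign_in B i * sign_in C i = sign_in A i + sign_in B i + sign_in C i - 2
      + 4 * of_bool (i \<in> A \<inter> B) + 4 * of_bool (i \<in> A \<inter> C) + 4 * of_bool (i \<in> B \<inter> C) - 8 * of_bool (i \<in> A \<inter> B \<inter> C)" for i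
    by (auto simp: sign_in_def)
  then have "(\<Sum>i<10. sign_in A i * sign_in B i * sign_in C i) =
      (\<Sum>i<10. sign_in A i) + (\<Sum>i<10. sign_in B i) + (\<Sum>i<10. sign_in C i) - (\<Sum>i<10::nat. 2)
      + 4 * (\<Sum>i<10::nat. of_bool (i \<in> A \<inter> B)) + 4 * (\<Sum>i<10::nat. of_bool (i \<in> A \<inter> C))
      + 4 * (\<Sum>i<10::nat. of_bool (i \<in> B \<inter> C)) - 8 * (\<Sum>i<10::nat. of_bool (i \<in> A \<inter> B \<inter> C))"
    by (simp only: sum_distrib_left sum_subtractf sum.distrib)
  moreover have "A \<inter> B \<subseteq> {..<10}" "A \<inter> C \<subseteq> {..<10}" "B \<inter> C \<subseteq> {..<10}" "A \<inter> B \<inter> C \<subseteq> {..<10}" using assms by auto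
  ultimately show ?thesis
    by (simp only: sum_sign_in[OF assms(1)] sum_sign_in[OF assms(2)] sum_sign_in[OF assms(3)] sum_of_bool_mem) simp
qed

section \<open>Counting the triples with up to three prescribed parities\<close>

definition parity_sign :: "bool \<Rightarrow> int" where
  "parity_sign b = (if b then - 1 else 1)"

text \<open>An equation over the field with two elements has the indicator (1 + sign times
  character) / 2. Multiplying these factors for several equations and summing over
  \<open>triples\<close> turns a number of solutions into values of \<open>kraw\<close>; the factor
  2 keeps everything in the integers.\<close>

lemma parity_indicator:
  "finite c \<Longrightarrow> 2 * of_bool (odd (card (c \<inter> A)) = b) = 1 + parity_sign b * (\<Prod>i\<in>c. sign_in A i)"
  by (auto simp: prod_sign_in parity_sign_def)

lemma finite_triple: "c \<in> triples \<Longrightarrow> finite c"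
  using finite_subset by (auto simp: triples_def)

text \<open>The parity is prescribed for the vector, not for the neighbour that carries it. This is
  adequate when distinct neighbours have distinct vectors, which \<open>layered_coloring\<close>
  maintains.\<close>

definition matching :: "nat set set \<Rightarrow> (nat set \<Rightarrow> bool) \<Rightarrow> nat set set" where
  "matching X b = {c \<in> triples. \<forall>A\<in>X. odd (card (c \<inter> A)) = b A}"

lemma card_matching: "int (card (matching X b)) = (\<Sum>c\<in>triples. of_bool (\<forall>A\<in>X. odd (card (c \<inter> A)) = b A))"
  by (simp add: matching_def Collect_conj_eq Int_commute)

lemma card_matching_0: "card (matching {} b) = 120"
  by (simp add: matching_def card_triples)

text \<open>A triple has \<open>p = 10 - 2 * 3 = 4\<close> and \<open>kraw 4 = - 8\<close>, so the
  count is (120 - 8) / 2 or (120 + 8) / 2.\<close>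

lemma card_matching_1:
  assumes A: "A \<in> triples"
  shows "card (matching {A} b) \<ge> 56"
proof -
  define \<alpha> where "\<alpha> = parity_sign (b A)"
  have "2 * int (card (matching {A} b)) = (\<Sum>c\<in>triples. 1 + \<alpha> * (\<Prod>i\<in>c. sign_in A i))"
    unfolding card_matching sum_distrib_left \<alpha>_def
    by (rule sum.cong) (simp_all add: parity_indicator finite_triple)
  also have "\<dots> = 120 + \<alpha> * kraw 4"
    using A unfolding sum.distrib sum_distrib_left[symmetric] sum_triples[OF sign_in_sq]
    by (simp add: sum_sign_in triples_def card_triples[unfolded triples_def])
  finally show ?thesis by (simp add: \<alpha>_def parity_sign_def kraw_def split: if_splits)
qed

lemma card_Int_triples:
  assumes "A \<in> triples" "B \<in> triples" "A \<noteq> B"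
  shows "card (A \<inter> B) \<le> 2"
proof (rule ccontr)
  assume "\<not> ?thesis"
  then have "card (A \<inter> B) \<ge> card A" "card (A \<inter> B) \<ge> card B" using assms by (auto simp: triples_def)
  then have "A \<inter> B = A" "A \<inter> B = B" using assms finite_triple card_seteq[of A "A \<inter> B"] card_seteq[of B "A \<inter> B"] by auto
  then show False using assms by auto
qed

text \<open>For intersections of size 0, 1, 2 the mixed term is 8, -8, 8 up to sign. So three terms
  of absolute value 8 are added to 120, and (120 - 24) / 4 = 24.\<close>

lemma card_matching_2:
  assumes A: "A \<in> triples" and B: "B \<in> triples" and "A \<noteq> B"
  shows "card (matching {A, B} b) \<ge> 24"
proof -
  define \<alpha> \<beta> where "\<alpha> = parity_sign (b A)" and "\<beta> = parity_sign (b B)"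
  have sub: "A \<subseteq> {..<10}" "B \<subseteq> {..<10}" and c3: "card A = 3" "card B = 3" using A B by (auto simp: triples_def)
  have sq: "sign_in A i * sign_in B i * (sign_in A i * sign_in B i) = 1" for i by (simp add: sign_in_def)
  have "4 * int (card (matching {A, B} b)) =
      (\<Sum>c\<in>triples. (2 * of_bool (odd (card (c \<inter> A)) = b A)) * (2 * of_bool (odd (card (c \<inter> B)) = b B)))"
    unfolding card_matching sum_distrib_left by (rule sum.cong) auto
  also have "\<dots> = (\<Sum>c\<in>triples. 1 + \<alpha> * (\<Prod>i\<in>c. sign_in A i) + \<beta> * (\<Prod>i\<in>c. sign_in B i)
      + \<alpha> * \<beta> * (\<Prod>i\<in>c. sign_in A i * sign_in B i))"
    unfolding \<alpha>_def \<beta>_def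
    by (rule sum.cong) (simp_all only: parity_indicator finite_triple prod.distrib, simp add: algebra_simps)
  also have "\<dots> = 120 + \<alpha> * kraw 4 + \<beta> * kraw 4 + \<alpha> * \<beta> * kraw (4 * int (card (A \<inter> B)) - 2)"
    unfolding sum.distrib sum_distrib_left[symmetric] sum_triples[OF sign_in_sq] sum_triples[OF sq]
      sum_sign_in[OF sub(1)] sum_sign_in[OF sub(2)] sum_sign_in2[OF sub] c3
    by (simp add: card_triples)
  finally have eq: "4 * int (card (matching {A, B} b)) =
    120 + \<alpha> * kraw 4 + \<beta> * kraw 4 + \<alpha> * \<beta> * kraw (4 * int (card (A \<inter> B)) - 2)" .
  have "card (A \<inter> B) \<in> {0, 1, 2}" using card_Int_triples[OF assms] by auto
  moreover have "\<alpha> \<in> {- 1, 1}" "\<beta> \<in> {- 1, 1}" by (auto simp: \<alpha>_def \<beta>_def parity_sign_def)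
  ultimately show ?thesis using eq by (auto simp: kraw_def)
qed

text \<open>If \<open>q\<close> is small, seven terms of absolute value at most 8 still leave 64. If
  \<open>q\<close> is 48 or -48, the listed patterns of \<open>k\<close>, \<open>l\<close>,
  \<open>m\<close> keep the six other terms at a sum of at least -16 whenever the last term is
  negative; 120 - 16 - 48 = 56 is attained.\<close>

lemma sign_bound:
  fixes \<alpha> \<beta> \<gamma> :: int
  assumes "\<alpha> \<in> {- 1, 1}" "\<beta> \<in> {- 1, 1}" "\<gamma> \<in> {- 1, 1}"
    and "k \<in> {- 8, 8}" "l \<in> {- 8, 8}" "m \<in> {- 8, 8}"
    and "q \<in> {- 8, 0, 8} \<or> (k, l, m) = (8, 8, 8) \<and> q \<in> {- 48, 48} \<or>
      (k, l, m) \<in> {(8, - 8, - 8), (- 8, 8, - 8), (- 8, - 8, 8)} \<and> q = 48"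
  shows "56 \<le> 120 - 8 * \<alpha> - 8 * \<beta> - 8 * \<gamma> + \<alpha> * \<beta> * k + \<alpha> * \<gamma> * l + \<beta> * \<gamma> * m + \<alpha> * \<beta> * \<gamma> * q"
proof -
  have cases: "\<alpha> = - 1 \<or> \<alpha> = 1" "\<beta> = - 1 \<or> \<beta> = 1" "\<gamma> = - 1 \<or> \<gamma> = 1" using assms(1-3) by auto
  have le: "- 8 \<le> a * b * j" if "a = - 1 \<or> a = 1" "b = - 1 \<or> b = 1" "j \<in> {- 8, 8}" for a b j :: int
    using that by auto
  have "q \<in> {- 8, 0, 8} \<Longrightarrow> - 8 \<le> \<alpha> * \<beta> * \<gamma> * q" using cases by auto
  then consider "- 8 \<le> \<alpha> * \<beta> * \<gamma> * q" | "k = 8" "l = 8" "m = 8" "q = - 48 \<or> q = 48"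
    | "k = 8" "l = - 8" "m = - 8" "q = 48" | "k = - 8" "l = 8" "m = - 8" "q = 48" | "k = - 8" "l = - 8" "m = 8" "q = 48"
    using assms(7) by auto
  then show ?thesis
  proof cases
    case 1
    then show ?thesis
      using le[OF cases(1,2) assms(4)] le[OF cases(1,3) assms(5)] le[OF cases(2,3) assms(6)] cases by linarith
  qed (use cases in \<open>elim disjE; simp\<close>)+
qed

lemma kraw_values:
  "kraw (- 2) = 8" "kraw 2 = - 8" "kraw 6 = 8" "kraw 4 = - 8" "kraw (- 4) = 8" "kraw 0 = 0"
  "kraw 8 = 48" "kraw (- 8) = - 48"
  by (simp_all add: kraw_def)


text \<open>Here \<open>x\<close>, \<open>y\<close>, \<open>z\<close> are the sizes of the pairwise
  intersections of three triples and \<open>w\<close> that of the triple one. The value of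
  \<open>q\<close> is 48 or -48 only if the symmetric difference of all three has 1 or 9 elements:
  for pairwise disjoint triples, for \<open>x = y = z = 2\<close> with \<open>w = 1\<close>, and for
  pairwise sizes 2, 1, 1 in some order with \<open>w = 0\<close>.\<close>

lemma kraw_Int_cases:
  fixes x y z w :: nat
  assumes "x \<in> {0, 1, 2}" "y \<in> {0, 1, 2}" "z \<in> {0, 1, 2}" "w \<in> {0, 1, 2}"
    "x + y \<le> 3 + w" "x + z \<le> 3 + w" "y + z \<le> 3 + w" "w \<le> x" "w \<le> y" "w \<le> z"
  defines "k \<equiv> kraw (4 * int x - 2)" and "l \<equiv> kraw (4 * int y - 2)" and "m \<equiv> kraw (4 * int z - 2)"
    and "q \<equiv> kraw (4 * (int x + int y + int z) - 8 * int w - 8)"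
  shows "k \<in> {- 8, 8}" "l \<in> {- 8, 8}" "m \<in> {- 8, 8}"
    "q \<in> {- 8, 0, 8} \<or> (k, l, m) = (8, 8, 8) \<and> q \<in> {- 48, 48} \<or>
      (k, l, m) \<in> {(8, - 8, - 8), (- 8, 8, - 8), (- 8, - 8, 8)} \<and> q = 48"
proof -
  show "k \<in> {- 8, 8}" "l \<in> {- 8, 8}" "m \<in> {- 8, 8}"
    using assms(1-3) by (auto simp: k_def l_def m_def kraw_values)
  show "q \<in> {- 8, 0, 8} \<or> (k, l, m) = (8, 8, 8) \<and> q \<in> {- 48, 48} \<or>
      (k, l, m) \<in> {(8, - 8, - 8), (- 8, 8, - 8), (- 8, - 8, 8)} \<and> q = 48"
    using assms(1-10) unfolding k_def l_def m_def q_def insert_iff empty_iff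
    by (elim disjE) (simp_all add: kraw_values)
qed

text \<open>Eight times the count is the sum that \<open>sign_bound\<close> bounds by 56. Treating
  its terms independently would be too weak, so the possible intersection sizes have to be examined
  jointly.\<close>

lemma card_matching_3:
  assumes A: "A \<in> triples" and B: "B \<in> triples" and C: "C \<in> triples" and ne: "A \<noteq> B" "A \<noteq> C" "B \<noteq> C"
  shows "card (matching {A, B, C} b) \<ge> 7"
proof -
  define \<alpha> \<beta> \<gamma> where "\<alpha> = parity_sign (b A)" and "\<beta> = parity_sign (b B)" and "\<gamma> = parity_sign (b C)"
  have sub: "A \<subseteq> {..<10}" "B \<subseteq> {..<10}" "C \<subseteq> {..<10}" and c3: "card A = 3" "card B = 3" "card C = 3"
    using A B C by (auto simp: triples_def)
  have sq: "sign_in D i * sign_in F i * (sign_in D i * sign_in F i) = 1" for i D F by (simp add: sign_in_def)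
  have sq3: "sign_in A i * sign_in B i * sign_in C i * (sign_in A i * sign_in B i * sign_in C i) = 1" for i
    by (simp add: sign_in_def)
  have "8 * int (card (matching {A, B, C} b)) =
      (\<Sum>c\<in>triples. (2 * of_bool (odd (card (c \<inter> A)) = b A)) * (2 * of_bool (odd (card (c \<inter> B)) = b B))
        * (2 * of_bool (odd (card (c \<inter> C)) = b C)))"
    unfolding card_matching sum_distrib_left by (rule sum.cong) auto
  also have "\<dots> = (\<Sum>c\<in>triples. 1 + \<alpha> * (\<Prod>i\<in>c. sign_in A i) + \<beta> * (\<Prod>i\<in>c. sign_in B i) + \<gamma> * (\<Prod>i\<in>c. sign_in C i)
      + \<alpha> * \<beta> * (\<Prod>i\<in>c. sign_in A i * sign_in B i) + \<alpha> * \<gamma> * (\<Prod>i\<in>c. sign_in A i * sign_in C i)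
      + \<beta> * \<gamma> * (\<Prod>i\<in>c. sign_in B i * sign_in C i)
      + \<alpha> * \<beta> * \<gamma> * (\<Prod>i\<in>c. sign_in A i * sign_in B i * sign_in C i))"
    unfolding \<alpha>_def \<beta>_def \<gamma>_def
    by (rule sum.cong) (simp_all only: parity_indicator finite_triple prod.distrib, simp add: algebra_simps)
  also have "\<dots> = 120 + \<alpha> * kraw 4 + \<beta> * kraw 4 + \<gamma> * kraw 4
      + \<alpha> * \<beta> * kraw (4 * int (card (A \<inter> B)) - 2) + \<alpha> * \<gamma> * kraw (4 * int (card (A \<inter> C)) - 2)
      + \<beta> * \<gamma> * kraw (4 * int (card (B \<inter> C)) - 2)
      + \<alpha> * \<beta> * \<gamma> * kraw (4 * (int (card (A \<inter> B)) + int (card (A \<inter> C)) + int (card (B \<inter> C)))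
          - 8 * int (card (A \<inter> B \<inter> C)) - 8)"
    unfolding sum.distrib sum_distrib_left[symmetric] sum_triples[OF sign_in_sq] sum_triples[OF sq] sum_triples[OF sq3]
      sum_sign_in[OF sub(1)] sum_sign_in[OF sub(2)] sum_sign_in[OF sub(3)]
      sum_sign_in2[OF sub(1,2)] sum_sign_in2[OF sub(1,3)] sum_sign_in2[OF sub(2,3)] sum_sign_in3[OF sub] c3
    by (simp add: card_triples algebra_simps)
  finally have eq: "8 * int (card (matching {A, B, C} b)) = \<dots>" .
  have le: "card (A \<inter> B) \<le> 2" "card (A \<inter> C) \<le> 2" "card (B \<inter> C) \<le> 2"
    using card_Int_triples A B C ne by auto
  have fin: "finite A" "finite B" "finite C" using A B C finite_triple by auto
  \<comment> \<open>Two subsets of \<open>D\<close> overlap in at least the sum of their sizes minus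
    \<open>card D\<close>; this rules out the bad combinations of intersection sizes.\<close>
  have IE: "card (D \<inter> F) + card (D \<inter> G) \<le> card D + card (D \<inter> F \<inter> G)" if "finite D" for D F G :: "nat set"
  proof -
    have "card (D \<inter> F) + card (D \<inter> G) = card (D \<inter> F \<union> D \<inter> G) + card (D \<inter> F \<inter> G)"
      using that by (subst card_Un_Int) (auto simp: Int_assoc Int_left_commute Int_left_absorb)
    also have "card (D \<inter> F \<union> D \<inter> G) \<le> card D" using that by (intro card_mono) auto
    finally show ?thesis by simp
  qed
  have t: "card (A \<inter> B) + card (A \<inter> C) \<le> 3 + card (A \<inter> B \<inter> C)"
    "card (A \<inter> B) + card (B \<inter> C) \<le> 3 + card (A \<inter> B \<inter> C)"
    "card (A \<inter> C) + card (B \<inter> C) \<le> 3 + card (A \<inter> B \<inter> C)"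
    using IE[OF fin(1), of B C] IE[OF fin(2), of A C] IE[OF fin(3), of A B] c3
    by (simp_all add: Int_commute Int_left_commute)
  have t': "card (A \<inter> B \<inter> C) \<le> card (A \<inter> B)" "card (A \<inter> B \<inter> C) \<le> card (A \<inter> C)" "card (A \<inter> B \<inter> C) \<le> card (B \<inter> C)"
    using fin by (auto intro!: card_mono)
  define x y z w where "x = card (A \<inter> B)" and "y = card (A \<inter> C)" and "z = card (B \<inter> C)" and "w = card (A \<inter> B \<inter> C)"
  have signs: "\<alpha> \<in> {- 1, 1}" "\<beta> \<in> {- 1, 1}" "\<gamma> \<in> {- 1, 1}" by (auto simp: \<alpha>_def \<beta>_def \<gamma>_def parity_sign_def)
  have cases: "x \<in> {0, 1, 2}" "y \<in> {0, 1, 2}" "z \<in> {0, 1, 2}" "w \<in> {0, 1, 2}"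
    using le t' unfolding x_def y_def z_def w_def by auto
  have bound: "x + y \<le> 3 + w" "x + z \<le> 3 + w" "y + z \<le> 3 + w" "w \<le> x" "w \<le> y" "w \<le> z"
    using t t' unfolding x_def y_def z_def w_def by auto
  have "56 \<le> 120 - 8 * \<alpha> - 8 * \<beta> - 8 * \<gamma>
      + \<alpha> * \<beta> * kraw (4 * int x - 2) + \<alpha> * \<gamma> * kraw (4 * int y - 2) + \<beta> * \<gamma> * kraw (4 * int z - 2)
      + \<alpha> * \<beta> * \<gamma> * kraw (4 * (int x + int y + int z) - 8 * int w - 8)"
    by (rule sign_bound[OF signs kraw_Int_cases[OF cases bound]])
  then show ?thesis using eq unfolding x_def y_def z_def w_def kraw_values(4) by linarith
qed

section \<open>Cycles as edge sets\<close>

fun walk_edges :: "'a list \<Rightarrow> 'a set set" where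
  "walk_edges (x # y # xs) = insert {x, y} (walk_edges (y # xs))"
| "walk_edges _ = {}"

lemma finite_walk_edges [simp]: "finite (walk_edges xs)"
  by (induction xs rule: walk_edges.induct) auto

lemma walk_edges_append:
  "walk_edges (xs @ x # ys) = walk_edges (xs @ [x]) \<union> walk_edges (x # ys)"
proof (induction xs)
  case (Cons y zs)
  then show ?case by (cases zs) auto
qed auto

lemma walk_edges_rev [simp]: "walk_edges (rev xs) = walk_edges xs"
proof (induction xs rule: walk_edges.induct)
  case (1 x y xs)
  have "walk_edges (rev (x # y # xs)) = walk_edges (rev xs @ y # [x])" by simp
  also have "\<dots> = walk_edges (rev (y # xs)) \<union> {{x, y}}"
    by (subst walk_edges_append) (auto simp: insert_commute)
  finally show ?case using 1 by auto
qed auto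

lemma walk_edges_subset_set: "e \<in> walk_edges xs \<Longrightarrow> e \<subseteq> set xs"
  by (induction xs rule: walk_edges.induct) auto

lemma Union_walk_edges: "length xs \<ge> 2 \<Longrightarrow> \<Union>(walk_edges xs) = set xs"
proof (induction xs rule: walk_edges.induct)
  case (1 x y xs)
  then show ?case by (cases xs) auto
qed auto

lemma card_walk_edges: "distinct xs \<Longrightarrow> card (walk_edges xs) = length xs - 1"
proof (induction xs rule: walk_edges.induct)
  case (1 x y xs)
  have "{x, y} \<notin> walk_edges (y # xs)"
    using 1 walk_edges_subset_set[of "{x,y}" "y # xs"] by auto
  with 1 show ?case by auto
qed auto

lemma degree_walk_edges:
  assumes "distinct xs" "length xs \<ge> 2"
  shows "card {e \<in> walk_edges xs. v \<in> e} =
    (if v \<notin> set xs then 0 else if v = hd xs \<or> v = last xs then 1 else 2)"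
  using assms
proof (induction xs rule: walk_edges.induct)
  case (1 x y xs)
  have new: "{x, y} \<notin> walk_edges (y # xs)"
    using 1 walk_edges_subset_set[of "{x,y}" "y # xs"] by auto
  have eq: "{e \<in> walk_edges (x # y # xs). v \<in> e} =
      (if v \<in> {x, y} then insert {x, y} {e \<in> walk_edges (y # xs). v \<in> e}
       else {e \<in> walk_edges (y # xs). v \<in> e})"
    by auto
  show ?case
  proof (cases xs)
    case Nil
    then show ?thesis using eq 1 by auto
  next
    case (Cons z zs)
    have IH: "card {e \<in> walk_edges (y # xs). v \<in> e} =
      (if v \<notin> set (y # xs) then 0 else if v = hd (y # xs) \<or> v = last (y # xs) then 1 else 2)"
      using 1 Cons by auto
    have "card {e \<in> walk_edges (x # y # xs). v \<in> e} =
      (if v \<in> {x, y} then 1 else 0) + card {e \<in> walk_edges (y # xs). v \<in> e}"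
      unfolding eq using new by auto
    then show ?thesis using IH 1 Cons by (auto split: if_splits)
  qed
qed auto

lemma walk_edges_ends:
  assumes "distinct (a # xs @ [b])" "{a, b} \<in> walk_edges (a # xs @ [b])"
  shows "xs = []"
proof (cases xs)
  case (Cons y ys)
  then have "{a, b} \<in> walk_edges (y # ys @ [b])"
    using assms by (auto simp: doubleton_eq_iff)
  then have "a \<in> set (y # ys @ [b])" using walk_edges_subset_set by fastforce
  then show ?thesis using assms Cons by auto
qed auto

text \<open>An edge set forgets starting point and direction, so that two paths combine to a cycle
  by a mere union.\<close>

definition cycle_on :: "'a set set \<Rightarrow> 'a set \<Rightarrow> bool" where
  "cycle_on S U \<longleftrightarrow> (\<exists>xs. distinct xs \<and> length xs \<ge> 3 \<and> set xs = U \<and> S = walk_edges (xs @ [hd xs]))"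

text \<open>Go along the first path and return along the second one reversed. With \<open>xs\<close>
  and \<open>ys\<close> both empty, the two paths would be the same edge.\<close>

lemma cycle_onI:
  assumes "distinct (a # xs @ b # ys)" "xs \<noteq> [] \<or> ys \<noteq> []"
  shows "cycle_on (walk_edges (a # xs @ [b]) \<union> walk_edges (a # ys @ [b]))
    ({a, b} \<union> set xs \<union> set ys)"
  unfolding cycle_on_def
proof (intro exI conjI)
  let ?zs = "a # xs @ b # rev ys"
  show "distinct ?zs" "3 \<le> length ?zs" "set ?zs = {a, b} \<union> set xs \<union> set ys"
    using assms by (auto simp: Suc_le_eq length_greater_0_conv[symmetric] simp del: length_greater_0_conv)
  have "walk_edges (?zs @ [hd ?zs]) = walk_edges ((a # xs) @ b # (rev ys @ [a]))" by simp
  also have "\<dots> = walk_edges (a # xs @ [b]) \<union> walk_edges (rev (a # ys @ [b]))"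
    by (subst walk_edges_append) simp
  finally show "walk_edges (a # xs @ [b]) \<union> walk_edges (a # ys @ [b]) = walk_edges (?zs @ [hd ?zs])"
    by (simp only: walk_edges_rev)
qed

lemma walk_edges_rotate1:
  assumes "xs \<noteq> []"
  shows "walk_edges (rotate1 xs @ [hd (rotate1 xs)]) = walk_edges (xs @ [hd xs])"
proof -
  obtain y ys where xs: "xs = y # ys" using assms by (cases xs) auto
  show ?thesis
  proof (cases ys)
    case (Cons z zs)
    have "walk_edges (rotate1 xs @ [hd (rotate1 xs)]) = walk_edges ((z # zs) @ y # [z])"
      using xs Cons by simp
    also have "\<dots> = walk_edges (xs @ [hd xs])"
      using xs Cons by (subst walk_edges_append) auto
    finally show ?thesis .
  qed (use xs in simp)
qed

lemma walk_edges_rotate: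
  assumes "xs \<noteq> []"
  shows "walk_edges (rotate n xs @ [hd (rotate n xs)]) = walk_edges (xs @ [hd xs])"
  using assms by (induction n) (auto simp: walk_edges_rotate1)

text \<open>Converse of \<open>cycle_onI\<close>: rotate the list until \<open>a\<close> is in
  front, cut it at \<open>b\<close> and read the second piece backwards.\<close>

lemma cycle_onE:
  assumes "cycle_on S U" "a \<in> U" "b \<in> U" "a \<noteq> b"
  obtains xs ys where "distinct (a # xs @ b # ys)" "xs \<noteq> [] \<or> ys \<noteq> []"
    "U = {a, b} \<union> set xs \<union> set ys"
    "S = walk_edges (a # xs @ [b]) \<union> walk_edges (a # ys @ [b])"
proof -
  obtain zs where zs: "distinct zs" "length zs \<ge> 3" "set zs = U" "S = walk_edges (zs @ [hd zs])"
    using assms unfolding cycle_on_def by auto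
  obtain us vs where us: "zs = us @ a # vs" using assms zs split_list by metis
  define ws where "ws = rotate (length us) zs"
  have ws: "ws = a # vs @ us" unfolding ws_def us by (simp add: rotate_append)
  have "distinct ws" "length ws \<ge> 3" "set ws = U" using zs unfolding ws_def by auto
  moreover have "S = walk_edges (ws @ [hd ws])"
    unfolding ws_def using zs by (subst walk_edges_rotate) auto
  moreover obtain xs ys where xy: "vs @ us = xs @ b # ys"
    using assms ws \<open>set ws = U\<close> by (metis set_ConsD split_list)
  moreover have "walk_edges ((a # xs) @ b # (ys @ [a])) = walk_edges ((a # xs) @ [b]) \<union> walk_edges (rev (b # ys @ [a]))"
    by (subst walk_edges_append) (simp only: walk_edges_rev)
  ultimately have "distinct (a # xs @ b # rev ys)" "xs \<noteq> [] \<or> rev ys \<noteq> []"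
    "U = {a, b} \<union> set xs \<union> set (rev ys)"
    "S = walk_edges (a # xs @ [b]) \<union> walk_edges (a # rev ys @ [b])"
    unfolding ws by auto
  then show ?thesis by (rule that)
qed

lemma card_walk_edge: "distinct xs \<Longrightarrow> e \<in> walk_edges xs \<Longrightarrow> card e = 2"
  by (induction xs rule: walk_edges.induct) auto

text \<open>The paths share only \<open>a\<close> and \<open>b\<close>, so a common edge is
  \<open>{a, b}\<close>; by \<open>walk_edges_ends\<close> both paths would then consist of this
  edge alone.\<close>

lemma walk_edges_Int:
  assumes "distinct (a # xs @ b # ys)" "xs \<noteq> [] \<or> ys \<noteq> []"
  shows "walk_edges (a # xs @ [b]) \<inter> walk_edges (a # ys @ [b]) = {}"
proof (rule ccontr)
  assume "\<not> ?thesis"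
  then obtain e where e: "e \<in> walk_edges (a # xs @ [b])" "e \<in> walk_edges (a # ys @ [b])" by auto
  have d: "distinct (a # xs @ [b])" "distinct (a # ys @ [b])" using assms by auto
  have "e \<subseteq> set (a # xs @ [b]) \<inter> set (a # ys @ [b])"
    using e walk_edges_subset_set by blast
  also have "\<dots> \<subseteq> {a, b}" using assms by auto
  finally have sub: "e \<subseteq> {a, b}" .
  have "card {a, b} \<le> card e" using card_walk_edge[OF d(1) e(1)] by (simp add: card_insert_if)
  then have "e = {a, b}" using sub by (intro card_seteq) auto
  then have "xs = []" "ys = []" using e walk_edges_ends[OF d(1)] walk_edges_ends[OF d(2)] by blast+
  then show False using assms by simp
qed

lemma cycle_on_degree:
  assumes "cycle_on S U"
  shows "card {e \<in> S. v \<in> e} = (if v \<in> U then 2 else 0)"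
proof -
  obtain zs where "distinct zs" "length zs \<ge> 3" "set zs = U" using assms by (auto simp: cycle_on_def)
  then have "card U \<ge> 3" by (metis distinct_card)
  then obtain b c where bc: "b \<in> U" "c \<in> U" "b \<noteq> c"
    by (metis card_le_Suc0_iff_eq card.infinite not_less_eq_eq numeral_3_eq_3 le_SucI le0)
  \<comment> \<open>A vertex \<open>v\<close> on the cycle is used as a cutting point: each of the
    two paths then contributes one edge at \<open>v\<close>.\<close>
  obtain a b where ab: "a \<in> U" "b \<in> U" "a \<noteq> b" "v \<in> U \<longrightarrow> v = a"
    using bc by (cases "v = b") metis+
  obtain xs ys where d: "distinct (a # xs @ b # ys)" "xs \<noteq> [] \<or> ys \<noteq> []"
    "U = {a, b} \<union> set xs \<union> set ys" and
    S: "S = walk_edges (a # xs @ [b]) \<union> walk_edges (a # ys @ [b])"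
    using cycle_onE[OF assms ab(1-3)] by metis
  have "{e \<in> S. v \<in> e} = {e \<in> walk_edges (a # xs @ [b]). v \<in> e} \<union> {e \<in> walk_edges (a # ys @ [b]). v \<in> e}"
    unfolding S by auto
  moreover have "card \<dots> = card {e \<in> walk_edges (a # xs @ [b]). v \<in> e} + card {e \<in> walk_edges (a # ys @ [b]). v \<in> e}"
    by (rule card_Un_disjoint) (use walk_edges_Int[OF d(1,2)] in auto)
  moreover have "card {e \<in> walk_edges (a # xs @ [b]). v \<in> e} =
      (if v \<notin> set (a # xs @ [b]) then 0 else if v = a \<or> v = b then 1 else 2)"
    using d(1) by (subst degree_walk_edges) auto
  moreover have "card {e \<in> walk_edges (a # ys @ [b]). v \<in> e} =
      (if v \<notin> set (a # ys @ [b]) then 0 else if v = a \<or> v = b then 1 else 2)"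
    using d(1) by (subst degree_walk_edges) auto
  ultimately have sum: "card {e \<in> S. v \<in> e} =
      (if v \<notin> set (a # xs @ [b]) then 0 else if v = a \<or> v = b then 1 else 2) +
      (if v \<notin> set (a # ys @ [b]) then 0 else if v = a \<or> v = b then 1 else 2)" by simp
  show ?thesis
  proof (cases "v \<in> U")
    case True
    then have "v = a" using ab(4) by blast
    then show ?thesis unfolding sum using True by simp
  next
    case False
    then have "v \<notin> set (a # xs @ [b])" "v \<notin> set (a # ys @ [b])" unfolding d(3) by auto
    then show ?thesis unfolding sum using False by simp
  qed
qed

lemma card_cycle_on:
  assumes "cycle_on S U"
  shows "card S = card U" "finite U" "finite S" "card U \<ge> 3" "\<Union>S = U"
proof -
  obtain zs where zs: "distinct zs" "length zs \<ge> 3" "set zs = U" "S = walk_edges (zs @ [hd zs])"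
    using assms by (auto simp: cycle_on_def)
  then show "finite U" "finite S" and 3: "card U \<ge> 3" by (auto simp: distinct_card)
  show "\<Union>S = U"
  proof -
    have "zs \<noteq> []" using zs(2) by auto
    then have "\<Union>S = set (zs @ [hd zs])" unfolding zs(4) using zs(2) by (intro Union_walk_edges) simp
    then show ?thesis using \<open>zs \<noteq> []\<close> zs(3) by auto
  qed
  obtain a b where ab: "a \<in> U" "b \<in> U" "a \<noteq> b"
    using 3 by (metis card_le_Suc0_iff_eq card.infinite not_less_eq_eq numeral_3_eq_3 le_SucI le0)
  obtain xs ys where d: "distinct (a # xs @ b # ys)" "xs \<noteq> [] \<or> ys \<noteq> []"
    "U = {a, b} \<union> set xs \<union> set ys" and
    S: "S = walk_edges (a # xs @ [b]) \<union> walk_edges (a # ys @ [b])"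
    using cycle_onE[OF assms ab(1-3)] by metis
  have "card S = card (walk_edges (a # xs @ [b])) + card (walk_edges (a # ys @ [b]))"
    unfolding S by (rule card_Un_disjoint) (use walk_edges_Int[OF d(1,2)] in auto)
  moreover have "card U = length (a # xs @ b # ys)"
    using d distinct_card[OF d(1)] by (simp add: Un_assoc insert_commute)
  ultimately show "card S = card U"
    using card_walk_edges[of "a # xs @ [b]"] card_walk_edges[of "a # ys @ [b]"] d by auto
qed

section \<open>Plane drawings and the insides of cycles\<close>

text \<open>The side of a cycle on which an edge lies is decided by the interior of the edge; this
  transfers the result to the ends as limits.\<close>

lemma simple_path_image_subset_closure:
  fixes c :: "real \<Rightarrow> complex"
  assumes "simple_path c"
  shows "path_image c \<subseteq> closure (path_image c - {pathstart c, pathfinish c})"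
proof -
  have "c ` {0..1} = c ` closure {0<..<1}" by simp
  also have "\<dots> \<subseteq> closure (c ` {0<..<1})"
    by (rule image_closure_subset)
      (use assms simple_path_imp_path[of c] in \<open>auto simp: path_def intro: closure_subset[THEN subsetD]\<close>)
  finally show ?thesis
    unfolding simple_path_endless[OF assms] by (simp add: path_image_def)
qed

locale plane_graph =
  fixes V :: "'a set" and E :: "'a set set" and p :: "'a \<Rightarrow> complex" and g :: "'a set \<Rightarrow> real \<Rightarrow> complex"
  assumes graph: "simple_graph V E" and drawing: "plane_drawing V E p g"
begin

lemma finite_V: "finite V" and edge_subset: "e \<in> E \<Longrightarrow> e \<subseteq> V" and card_edge: "e \<in> E \<Longrightarrow> card e = 2"
  using graph by (auto simp: simple_graph_def)

lemma finite_E: "finite E"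
  by (rule finite_subset[of _ "Pow V"]) (use edge_subset finite_V in auto)

lemma inj_p: "inj_on p V"
  using drawing by (simp add: plane_drawing_def)

lemma arc_edge: "e \<in> E \<Longrightarrow> arc (g e)"
  and ends_edge: "e \<in> E \<Longrightarrow> {pathstart (g e), pathfinish (g e)} = p ` e"
  and edge_vertices: "e \<in> E \<Longrightarrow> path_image (g e) \<inter> p ` V = p ` e"
  and edges_Int: "e \<in> E \<Longrightarrow> e' \<in> E \<Longrightarrow> e \<noteq> e' \<Longrightarrow> path_image (g e) \<inter> path_image (g e') = p ` (e \<inter> e')"
  using drawing by (auto simp: plane_drawing_def)

section \<open>Paths and cycles of the graph as arcs and closed curves\<close>

definition support :: "'a set set \<Rightarrow> complex set" where
  "support S = (\<Union>e\<in>S. path_image (g e))"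

lemma support_Un: "support (S \<union> T) = support S \<union> support T"
  by (auto simp: support_def)

lemma vertex_in_edge: "e \<in> E \<Longrightarrow> v \<in> e \<Longrightarrow> p v \<in> path_image (g e)"
  using edge_vertices by blast

lemma support_Int:
  assumes "S \<subseteq> E" "T \<subseteq> E" "S \<inter> T = {}"
  shows "support S \<inter> support T = p ` (\<Union>S \<inter> \<Union>T)"
proof (intro subset_antisym subsetI)
  fix z assume "z \<in> support S \<inter> support T"
  then obtain e e' where e: "e \<in> S" "e' \<in> T" "z \<in> path_image (g e) \<inter> path_image (g e')"
    by (auto simp: support_def)
  then have "z \<in> p ` (e \<inter> e')" using edges_Int[of e e'] assms by auto
  then show "z \<in> p ` (\<Union>S \<inter> \<Union>T)" using e by auto
next
  fix z assume "z \<in> p ` (\<Union>S \<inter> \<Union>T)"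
  then obtain v e e' where v: "z = p v" and e: "e \<in> S" "v \<in> e" and e': "e' \<in> T" "v \<in> e'" by auto
  have "e \<in> E" "e' \<in> E" using e(1) e'(1) assms(1,2) by auto
  then have "z \<in> path_image (g e)" "z \<in> path_image (g e')" using vertex_in_edge e(2) e'(2) v by auto
  then show "z \<in> support S \<inter> support T" using e(1) e'(1) by (auto simp: support_def)
qed

lemma support_vertex_iff:
  assumes "S \<subseteq> E" "v \<in> V"
  shows "p v \<in> support S \<longleftrightarrow> v \<in> \<Union>S"
proof
  assume "p v \<in> support S"
  then obtain e where e: "e \<in> S" "p v \<in> path_image (g e)" by (auto simp: support_def)
  then have "p v \<in> p ` e" using edge_vertices[of e] assms by auto
  then obtain w where "w \<in> e" "p v = p w" by auto
  then have "v = w" using inj_onD[OF inj_p] edge_subset[of e] e assms by auto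
  then show "v \<in> \<Union>S" using e \<open>w \<in> e\<close> by auto
qed (use assms vertex_in_edge in \<open>auto simp: support_def\<close>)

lemma edge_arc:
  assumes "{a, b} \<in> E"
  obtains h where "arc h" "pathstart h = p a" "pathfinish h = p b" "path_image h = path_image (g {a, b})"
proof (cases "pathstart (g {a, b}) = p a \<and> pathfinish (g {a, b}) = p b")
  case True
  then show ?thesis using that arc_edge[OF assms] by blast
next
  case False
  then have "pathstart (g {a, b}) = p b \<and> pathfinish (g {a, b}) = p a"
    using ends_edge[OF assms] by (auto simp: doubleton_eq_iff)
  then show ?thesis
    using that[of "reversepath (g {a, b})"] arc_edge[OF assms] arc_reversepath by auto
qed

lemma path_arc:
  assumes "distinct (a # xs @ [b])" "walk_edges (a # xs @ [b]) \<subseteq> E"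
  shows "\<exists>h. arc h \<and> pathstart h = p a \<and> pathfinish h = p b \<and> path_image h = support (walk_edges (a # xs @ [b]))"
  using assms
proof (induction xs arbitrary: a)
  case Nil
  then have "{a, b} \<in> E" by simp
  then obtain h where "arc h" "pathstart h = p a" "pathfinish h = p b" "path_image h = path_image (g {a, b})"
    by (rule edge_arc)
  then show ?case by (auto simp: support_def)
next
  case (Cons x xs)
  let ?T = "walk_edges (x # xs @ [b])"
  obtain h where h: "arc h" "pathstart h = p x" "pathfinish h = p b" "path_image h = support ?T"
    using Cons.IH[of x] Cons.prems by auto
  have ax: "{a, x} \<in> E" using Cons.prems by simp
  obtain k where k: "arc k" "pathstart k = p a" "pathfinish k = p x" "path_image k = path_image (g {a, x})"
    using edge_arc[OF ax] by blast
  have new: "{a, x} \<notin> ?T"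
    using Cons.prems walk_edges_subset_set[of "{a, x}" "x # xs @ [b]"] by auto
  have "path_image k = support {{a, x}}" using k by (simp add: support_def)
  then have "path_image k \<inter> path_image h = p ` ({a, x} \<inter> \<Union>?T)"
    using support_Int[of "{{a, x}}" ?T] Cons.prems new ax h by simp
  also have "\<dots> \<subseteq> {p x}"
    using Cons.prems walk_edges_subset_set by fastforce
  finally have Int: "path_image k \<inter> path_image h \<subseteq> {pathstart h}" using h by simp
  have "path_image (k +++ h) = support (walk_edges (a # (x # xs) @ [b]))"
    using h k by (simp add: path_image_join support_def)
  moreover have "arc (k +++ h)" using arc_join[OF k(1) h(1) _ Int] h k by simp
  ultimately show ?case using h k by (intro exI[of _ "k +++ h"]) simp
qed

lemma cycle_curve:
  assumes "cycle_on S U" "S \<subseteq> E"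
  obtains c where "simple_path c" "pathfinish c = pathstart c" "path_image c = support S"
proof -
  obtain a b where ab: "a \<in> U" "b \<in> U" "a \<noteq> b"
    using card_cycle_on[OF assms(1)]
    by (metis card_le_Suc0_iff_eq card.infinite not_less_eq_eq numeral_3_eq_3 le_SucI)
  obtain xs ys where d: "distinct (a # xs @ b # ys)" "xs \<noteq> [] \<or> ys \<noteq> []" and
    S: "S = walk_edges (a # xs @ [b]) \<union> walk_edges (a # ys @ [b])"
    using cycle_onE[OF assms(1) ab] by metis
  obtain h where h: "arc h" "pathstart h = p a" "pathfinish h = p b" "path_image h = support (walk_edges (a # xs @ [b]))"
    using path_arc[of a xs b] d assms S by auto
  obtain k where k: "arc k" "pathstart k = p a" "pathfinish k = p b" "path_image k = support (walk_edges (a # ys @ [b]))"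
    using path_arc[of a ys b] d assms S by auto
  have "path_image h \<inter> path_image k = p ` (set (a # xs @ [b]) \<inter> set (a # ys @ [b]))"
    unfolding h k using walk_edges_Int[OF d] assms S
    by (subst support_Int) (auto simp: Union_walk_edges simp del: set_simps)
  also have "\<dots> = {p a, p b}" using d by auto
  finally have "simple_path (h +++ reversepath k)"
    using h k by (intro simple_path_join_loop) (auto simp: arc_reversepath)
  moreover have "path_image (h +++ reversepath k) = support S"
    using h k S by (simp add: path_image_join support_Un)
  ultimately show ?thesis using that h k by simp
qed

lemma cycle_inside_outside:
  assumes "cycle_on S U" "S \<subseteq> E"
  shows "inside (support S) \<noteq> {}" "open (inside (support S))" "connected (inside (support S))"
    "open (outside (support S))" "connected (outside (support S))" "bounded (inside (support S))"
    "closure (inside (support S)) = inside (support S) \<union> support S"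
proof -
  obtain c where c: "simple_path c" "pathfinish c = pathstart c" and im: "path_image c = support S"
    using cycle_curve[OF assms] by blast
  note J = Jordan_inside_outside[OF c, unfolded im]
  show "inside (support S) \<noteq> {}" "open (inside (support S))" "connected (inside (support S))"
    "open (outside (support S))" "connected (outside (support S))" "bounded (inside (support S))"
    using J by auto
  show "closure (inside (support S)) = inside (support S) \<union> support S"
    using J by (metis closure_Un_frontier)
qed

section \<open>The side of a cycle on which edges and vertices lie\<close>

lemma edge_interior_Int_support:
  assumes "S \<subseteq> E" "e \<in> E" "e \<notin> S"
  shows "(path_image (g e) - p ` e) \<inter> support S = {}"
  using support_Int[of "{e}" S] assms by (auto simp: support_def)

lemma connected_edge_interior: "e \<in> E \<Longrightarrow> connected (path_image (g e) - p ` e)"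
  using connected_simple_path_endless[OF arc_imp_simple_path[OF arc_edge], of e] ends_edge[of e] by simp

lemma edge_subset_closure_interior: "e \<in> E \<Longrightarrow> path_image (g e) \<subseteq> closure (path_image (g e) - p ` e)"
  using simple_path_image_subset_closure[OF arc_imp_simple_path[OF arc_edge], of e] ends_edge[of e] by simp

text \<open>Meeting the inside is enough: by \<open>edges_inside_interior\<close> the open edge then
  lies inside completely, while its ends may be on the cycle.\<close>

definition edges_inside :: "'a set set \<Rightarrow> 'a set set" where
  "edges_inside S = {e \<in> E. path_image (g e) \<inter> inside (support S) \<noteq> {}}"

definition vertices_inside :: "'a set set \<Rightarrow> 'a set" where
  "vertices_inside S = {v \<in> V. p v \<in> inside (support S)}"

lemma edges_inside_disjoint: "edges_inside S \<inter> S = {}"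
proof -
  have "e \<notin> edges_inside S" if "e \<in> S" for e
    using inside_no_overlap[of "support S"] that unfolding edges_inside_def support_def by blast
  then show ?thesis by blast
qed

text \<open>The open edge is connected and avoids the curve.\<close>

lemma edge_side:
  assumes "cycle_on S U" "S \<subseteq> E" "e \<in> E" "e \<notin> S"
  shows "path_image (g e) - p ` e \<subseteq> inside (support S) \<or> path_image (g e) - p ` e \<subseteq> outside (support S)"
proof -
  let ?X = "path_image (g e) - p ` e"
  have "?X \<subseteq> inside (support S) \<union> outside (support S)"
    using edge_interior_Int_support[OF assms(2-4)] inside_Un_outside[of "support S"] by blast
  then show ?thesis
    using connectedD[OF connected_edge_interior[OF assms(3)] cycle_inside_outside(2,4)[OF assms(1,2)]]
      inside_Int_outside[of "support S"] by blast
qed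

text \<open>The point known to be inside might be an end of the edge. Since the inside is open,
  interior points of the edge close to it are inside as well.\<close>

lemma edges_inside_interior:
  assumes "cycle_on S U" "S \<subseteq> E" "e \<in> edges_inside S"
  shows "path_image (g e) - p ` e \<subseteq> inside (support S)"
proof -
  have e: "e \<in> E" "e \<notin> S" using assms(3) edges_inside_disjoint[of S] by (auto simp: edges_inside_def)
  obtain z where z: "z \<in> path_image (g e)" "z \<in> inside (support S)"
    using assms(3) by (auto simp: edges_inside_def)
  then have "z \<in> closure (path_image (g e) - p ` e)" using edge_subset_closure_interior e by blast
  then have "inside (support S) \<inter> (path_image (g e) - p ` e) \<noteq> {}"
    using cycle_inside_outside(2)[OF assms(1,2)] z open_Int_closure_eq_empty by blast
  then show ?thesis using edge_side[OF assms(1,2) e] inside_Int_outside[of "support S"] by blast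
qed

lemma edge_interior_nonempty: "e \<in> E \<Longrightarrow> path_image (g e) - p ` e \<noteq> {}"
  using edge_subset_closure_interior[of e] path_image_nonempty[of "g e"]
  by (metis closure_empty subset_empty)

lemma edges_inside_vertex:
  assumes "cycle_on S U" "S \<subseteq> E" "e \<in> edges_inside S" "v \<in> e" "v \<notin> U"
  shows "v \<in> vertices_inside S"
proof -
  have e: "e \<in> E" using assms by (auto simp: edges_inside_def)
  then have v: "v \<in> V" using edge_subset assms by auto
  have "p v \<in> closure (path_image (g e) - p ` e)"
    using vertex_in_edge[OF e assms(4)] edge_subset_closure_interior[OF e] by blast
  then have "p v \<in> inside (support S) \<union> support S"
    using closure_mono[OF edges_inside_interior[OF assms(1-3)]] cycle_inside_outside(7)[OF assms(1,2)] by blast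
  moreover have "p v \<notin> support S"
    using support_vertex_iff[OF assms(2) v] card_cycle_on(5)[OF assms(1)] assms(5) by simp
  ultimately show ?thesis using v by (simp add: vertices_inside_def)
qed

lemma vertices_inside_edge: "e \<in> E \<Longrightarrow> v \<in> e \<Longrightarrow> v \<in> vertices_inside S \<Longrightarrow> e \<in> edges_inside S"
  using vertex_in_edge by (auto simp: edges_inside_def vertices_inside_def)

lemma vertices_inside_disjoint:
  assumes "cycle_on S U" "S \<subseteq> E"
  shows "vertices_inside S \<inter> U = {}"
proof -
  have "v \<notin> U" if "v \<in> V" "p v \<in> inside (support S)" for v
    using that support_vertex_iff[OF assms(2) that(1)] card_cycle_on(5)[OF assms(1)]
      inside_no_overlap[of "support S"] by blast
  then show ?thesis by (auto simp: vertices_inside_def)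
qed

text \<open>The three paths form a theta-curve whose middle path \<open>T\<close> meets the inside
  of the cycle formed by the other two, so it cuts this inside into two parts.\<close>

lemma theta_inside:
  assumes "distinct (a # xs @ b # ys)" "xs \<noteq> [] \<or> ys \<noteq> []"
    and S1: "S1 = walk_edges (a # xs @ [b])" "S1 \<subseteq> E"
    and S2: "S2 = walk_edges (a # ys @ [b])" "S2 \<subseteq> E"
    and T: "T = walk_edges (a # ms @ [b])" "T \<subseteq> E"
    and "distinct ms" "set ms \<inter> ({a, b} \<union> set xs \<union> set ys) = {}"
    and ins: "T \<inter> edges_inside (S1 \<union> S2) \<noteq> {}"
  shows "cycle_on (S1 \<union> T) ({a, b} \<union> set xs \<union> set ms)"
    "cycle_on (S2 \<union> T) ({a, b} \<union> set ys \<union> set ms)"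
    "S1 \<inter> T = {}" "S2 \<inter> T = {}"
    "inside (support (S1 \<union> T)) \<inter> inside (support (S2 \<union> T)) = {}"
    "inside (support (S1 \<union> T)) \<union> inside (support (S2 \<union> T)) \<union> (support T - {p a, p b}) = inside (support (S1 \<union> S2))"
proof -
  obtain e where e: "e \<in> T" "e \<in> edges_inside (S1 \<union> S2)" using ins by blast
  then have "e \<notin> S1" "e \<notin> S2" using edges_inside_disjoint by blast+
  then have ne: "xs \<noteq> [] \<or> ms \<noteq> []" "ys \<noteq> [] \<or> ms \<noteq> []"
    using e(1) S1(1) S2(1) T(1) by auto
  have d1: "distinct (a # xs @ b # ms)" and d2: "distinct (a # ys @ b # ms)" using assms(1,9,10) by auto
  show "cycle_on (S1 \<union> T) ({a, b} \<union> set xs \<union> set ms)" unfolding S1 T by (rule cycle_onI[OF d1 ne(1)])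
  show "cycle_on (S2 \<union> T) ({a, b} \<union> set ys \<union> set ms)" unfolding S2 T by (rule cycle_onI[OF d2 ne(2)])
  have I1: "S1 \<inter> T = {}" and I2: "S2 \<inter> T = {}" and I12: "S1 \<inter> S2 = {}"
    unfolding S1(1) S2(1) T(1) by (rule walk_edges_Int[OF d1 ne(1)] walk_edges_Int[OF d2 ne(2)] walk_edges_Int[OF assms(1,2)])+
  then show "S1 \<inter> T = {}" "S2 \<inter> T = {}" by auto
  have U: "\<Union>S1 = set (a # xs @ [b])" "\<Union>S2 = set (a # ys @ [b])" "\<Union>T = set (a # ms @ [b])"
    unfolding S1(1) S2(1) T(1) by (intro Union_walk_edges; simp)+
  obtain c1 where c1: "arc c1" "pathstart c1 = p a" "pathfinish c1 = p b" "path_image c1 = support S1"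
    using path_arc[of a xs b] S1 d1 by auto
  obtain c2 where c2: "arc c2" "pathstart c2 = p a" "pathfinish c2 = p b" "path_image c2 = support S2"
    using path_arc[of a ys b] S2 d2 by auto
  obtain c where c: "arc c" "pathstart c = p a" "pathfinish c = p b" "path_image c = support T"
    using path_arc[of a ms b] T d1 by auto
  have set_Int: "set (a # us @ [b]) \<inter> set (a # vs @ [b]) = {a, b}"
    if "distinct (a # us @ b # vs)" for us vs using that by auto
  have X12: "support S1 \<inter> support S2 = {p a, p b}"
    unfolding support_Int[OF S1(2) S2(2) I12] U set_Int[OF assms(1)] by simp
  have X1: "support S1 \<inter> support T = {p a, p b}"
    unfolding support_Int[OF S1(2) T(2) I1] U set_Int[OF d1] by simp
  have X2: "support S2 \<inter> support T = {p a, p b}"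
    unfolding support_Int[OF S2(2) T(2) I2] U set_Int[OF d2] by simp
  have ab: "p a \<noteq> p b" using c(1-3) arc_distinct_ends by metis
  have meets: "support T \<inter> inside (support S1 \<union> support S2) \<noteq> {}"
    using e by (auto simp: edges_inside_def support_def support_Un)
  have A: "inside (support S1 \<union> support T) \<inter> inside (support S2 \<union> support T) = {} \<and>
      inside (support S1 \<union> support T) \<union> inside (support S2 \<union> support T) \<union> (support T - {p a, p b})
      = inside (support S1 \<union> support S2)"
    apply (rule split_inside_simple_closed_curve[of c1 "p a" "p b" c2 c])
    apply (use c1 c2 c in \<open>simp add: arc_imp_simple_path; fail\<close>)+
    apply (rule ab)
    apply (simp only: c1(4) c2(4) X12)
    apply (simp only: c1(4) c(4) X1)
    apply (simp only: c(4) c2(4) X2)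
    apply (simp only: c1(4) c2(4) c(4) meets not_False_eq_True)
    apply (simp only: c1(4) c2(4) c(4))
    done
  show "inside (support (S1 \<union> T)) \<inter> inside (support (S2 \<union> T)) = {}"
    unfolding support_Un by (rule conjunct1[OF A])
  show "inside (support (S1 \<union> T)) \<union> inside (support (S2 \<union> T)) \<union> (support T - {p a, p b}) = inside (support (S1 \<union> S2))"
    unfolding support_Un by (rule conjunct2[OF A])
qed

end

section \<open>Cycles covering each edge at most twice\<close>

text \<open>Connected and without cut vertex. Separations of order 0 and 1 are treated alike, so
  that one induction handles components and blocks.\<close>

definition nonseparable :: "'a set \<Rightarrow> 'a set set \<Rightarrow> bool" where
  "nonseparable V E \<longleftrightarrow> (\<forall>V1 V2. V1 \<union> V2 = V \<longrightarrow> card (V1 \<inter> V2) \<le> 1 \<longrightarrow>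
    (\<forall>e\<in>E. e \<subseteq> V1 \<or> e \<subseteq> V2) \<longrightarrow> V1 = V \<or> V2 = V)"

section \<open>Ears of nonseparable graphs\<close>

lemma rtrancl_distinct_path:
  assumes "(u, w) \<in> r\<^sup>*" "r \<subseteq> {(x, y). {x, y} \<in> E}"
  shows "\<exists>xs. distinct xs \<and> xs \<noteq> [] \<and> hd xs = u \<and> last xs = w \<and> walk_edges xs \<subseteq> E \<and> set xs \<subseteq> r\<^sup>* `` {u}"
  using assms(1)
proof (induction rule: converse_rtrancl_induct)
  case base
  show ?case by (intro exI[of _ "[w]"]) auto
next
  case (step u v)
  obtain xs where xs: "distinct xs" "xs \<noteq> []" "hd xs = v" "last xs = w" "walk_edges xs \<subseteq> E" "set xs \<subseteq> r\<^sup>* `` {v}"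
    using step.IH by blast
  have sub: "set xs \<subseteq> r\<^sup>* `` {u}" using xs(6) step.hyps(1) by (auto intro: converse_rtrancl_into_rtrancl)
  show ?case
  proof (cases "u \<in> set xs")
    case True
    then obtain ys zs where yz: "xs = ys @ u # zs" by (meson split_list)
    have "walk_edges (u # zs) \<subseteq> E" using xs(5) walk_edges_append[of ys u zs] yz by auto
    then show ?thesis using xs sub yz by (intro exI[of _ "u # zs"]) auto
  next
    case False
    obtain zs where zs: "xs = v # zs" using xs(2,3) by (cases xs) auto
    have "{u, v} \<in> E" using step.hyps(1) assms(2) by auto
    then show ?thesis using False xs sub zs by (intro exI[of _ "u # xs"]) auto
  qed
qed

text \<open>Let \<open>R\<close> be the component of \<open>y\<close> outside of \<open>U\<close>
  and \<open>A\<close> the set of its neighbours in \<open>U\<close>. If \<open>A\<close> had at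
  most one element, \<open>R \<union> A\<close> and \<open>V - R\<close> would separate the graph;
  so two elements of \<open>A\<close> are joined through \<open>R\<close>. The last conclusion lets
  \<open>inside_ear\<close> show that the ear stays inside a cycle.\<close>

lemma nonseparable_ear:
  assumes graph: "simple_graph V E" and ns: "nonseparable V E" and U: "U \<subseteq> V" "card U \<ge> 2" and y: "y \<in> V" "y \<notin> U"
  obtains a ms b where "a \<in> U" "b \<in> U" "a \<noteq> b" "distinct ms" "ms \<noteq> []" "set ms \<inter> U = {}"
    "walk_edges (a # ms @ [b]) \<subseteq> E" "set ms \<subseteq> {(u, w). {u, w} \<in> E \<and> u \<notin> U \<and> w \<notin> U}\<^sup>* `` {y}"
proof -
  define r where "r = {(u, w). {u, w} \<in> E \<and> u \<notin> U \<and> w \<notin> U}"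
  define R where "R = r\<^sup>* `` {y}"
  have R: "w \<in> V \<and> w \<notin> U" if "w \<in> R" for w
  proof -
    have "(y, w) \<in> r\<^sup>*" using that by (simp add: R_def)
    then show ?thesis
      by induction (use y graph in \<open>auto simp: r_def simple_graph_def\<close>)
  qed
  have step: "w' \<in> R" if "w \<in> R" "{w, w'} \<in> E" "w' \<notin> U" for w w'
    using that R[of w] by (auto simp: R_def r_def intro: rtrancl_into_rtrancl)
  define A where "A = {z \<in> U. \<exists>w\<in>R. {z, w} \<in> E}"
  have "finite U" using U(2) card.infinite by fastforce
  then have "finite A" by (simp add: A_def)
  have "\<not> card A \<le> 1"
  proof
    assume A1: "card A \<le> 1"
    have un: "(R \<union> A) \<union> (V - R) = V" using R U by (auto simp: A_def)
    have "(R \<union> A) \<inter> (V - R) = A" using R U by (auto simp: A_def)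
    then have ca: "card ((R \<union> A) \<inter> (V - R)) \<le> 1" using A1 by simp
    have ed: "\<forall>e\<in>E. e \<subseteq> R \<union> A \<or> e \<subseteq> V - R"
    proof (intro ballI disjCI)
      fix e assume e: "e \<in> E" "\<not> e \<subseteq> V - R"
      have eV: "e \<subseteq> V" "card e = 2" using graph e(1) by (auto simp: simple_graph_def)
      then obtain w where w: "w \<in> e" "w \<in> R" using e(2) by blast
      then obtain x where x: "e = {w, x}" using eV(2) by (auto simp: card_2_iff)
      show "e \<subseteq> R \<union> A"
      proof (cases "x \<in> U")
        case True
        then have "x \<in> A" using w x e(1) by (auto simp: A_def insert_commute)
        then show ?thesis using w x by simp
      next
        case False
        then have "x \<in> R" using step w x e(1) by simp
        then show ?thesis using w x by simp
      qed
    qed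
    have "R \<union> A = V \<or> V - R = V"
      using ns un ca ed unfolding nonseparable_def by blast
    then show False
    proof
      assume "R \<union> A = V"
      then have "U \<subseteq> A" using U R by blast
      then have "card U \<le> card A" using card_mono[OF \<open>finite A\<close>] by blast
      then show False using A1 U(2) by simp
    next
      assume "V - R = V"
      moreover have "y \<in> R" by (simp add: R_def)
      ultimately show False using y by blast
    qed
  qed
  then obtain a b where ab: "a \<in> A" "b \<in> A" "a \<noteq> b"
    using \<open>finite A\<close> by (metis card_le_Suc0_iff_eq One_nat_def)
  then obtain u w where uw: "{a, u} \<in> E" "u \<in> R" "{b, w} \<in> E" "w \<in> R" by (auto simp: A_def)
  have "sym r" by (auto simp: r_def sym_def insert_commute)
  then have "sym (r\<^sup>*)" by (rule sym_rtrancl)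
  then have "(u, y) \<in> r\<^sup>*" using uw(2) by (auto simp: R_def dest: symD)
  then have "(u, w) \<in> r\<^sup>*" using uw(4) by (auto simp: R_def)
  moreover have "r \<subseteq> {(x, y). {x, y} \<in> E}" by (auto simp: r_def)
  ultimately obtain ms where ms: "distinct ms" "ms \<noteq> []" "hd ms = u" "last ms = w" "walk_edges ms \<subseteq> E"
    "set ms \<subseteq> r\<^sup>* `` {u}" by (metis rtrancl_distinct_path)
  have msR: "set ms \<subseteq> R" using ms(6) uw(2) by (auto simp: R_def)
  have "walk_edges (a # ms @ [b]) \<subseteq> E"
  proof -
    obtain zs where zs: "ms = u # zs" using ms by (cases ms) auto
    obtain zs' where zs': "ms = zs' @ [w]" using ms by (metis append_butlast_last_id)
    have "walk_edges (a # ms @ [b]) = insert {a, u} (walk_edges (ms @ [b]))" unfolding zs by simp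
    also have "walk_edges (ms @ [b]) = walk_edges ms \<union> {{w, b}}"
      unfolding zs' using walk_edges_append[of zs' w "[b]"] by simp
    finally show ?thesis using ms(5) uw by (simp add: insert_commute)
  qed
  moreover have "a \<in> U" "b \<in> U" using ab by (auto simp: A_def)
  ultimately show ?thesis using that[of a b ms] ab(3) ms(1,2) msR R unfolding R_def r_def by blast
qed

text \<open>Families of cycles are lists, so multiplicities simply add under concatenation.\<close>

definition cover_count :: "'a set set list \<Rightarrow> 'a set \<Rightarrow> nat" where
  "cover_count F e = length (filter (\<lambda>C. e \<in> C) F)"

lemma cover_count_simps [simp]:
  "cover_count [] e = 0"
  "cover_count (C # F) e = (if e \<in> C then 1 else 0) + cover_count F e"
  "cover_count (F @ F') e = cover_count F e + cover_count F' e"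
  by (auto simp: cover_count_def)

section \<open>Cutting a disc along ears\<close>

context plane_graph
begin

lemma cycle_subset_V:
  assumes "cycle_on S U" "S \<subseteq> E"
  shows "U \<subseteq> V"
proof
  fix v assume "v \<in> U"
  then obtain e where "e \<in> S" "v \<in> e" using card_cycle_on(5)[OF assms(1)] by blast
  then show "v \<in> V" using edge_subset[of e] assms(2) by blast
qed

text \<open>An inner edge with both ends on the cycle is itself an ear. Otherwise start from an end
  \<open>y\<close> off the cycle: it lies inside, and so does every vertex reached from it without
  touching \<open>U\<close>, since edges do not cross the cycle.\<close>

lemma inside_ear:
  assumes ns: "nonseparable V E" and S: "cycle_on S U" "S \<subseteq> E" and ne: "edges_inside S \<noteq> {}"
  obtains a ms b where "a \<in> U" "b \<in> U" "a \<noteq> b" "distinct ms" "set ms \<inter> U = {}" "set ms \<subseteq> vertices_inside S"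
    "walk_edges (a # ms @ [b]) \<subseteq> E" "walk_edges (a # ms @ [b]) \<inter> edges_inside S \<noteq> {}"
proof -
  obtain e where e: "e \<in> edges_inside S" using ne by blast
  then have eE: "e \<in> E" by (simp add: edges_inside_def)
  show ?thesis
  proof (cases "e \<subseteq> U")
    case True
    obtain x y where "e = {x, y}" "x \<noteq> y" using card_edge[OF eE] by (auto simp: card_2_iff)
    with True e eE have "x \<in> U" "y \<in> U" "x \<noteq> y" "walk_edges (x # [] @ [y]) \<subseteq> E"
      "walk_edges (x # [] @ [y]) \<inter> edges_inside S \<noteq> {}" by simp_all
    then show ?thesis using that[of x y "[]"] by simp
  next
    case False
    then obtain y where y: "y \<in> e" "y \<notin> U" by blast
    have yV: "y \<in> V" using y(1) edge_subset[OF eE] by (rule rev_subsetD)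
    have UV: "U \<subseteq> V" using cycle_subset_V[OF S] .
    have U2: "card U \<ge> 2" using card_cycle_on(4)[OF S(1)] by simp
    obtain a ms b where ear: "a \<in> U" "b \<in> U" "a \<noteq> b" "distinct ms" "ms \<noteq> []" "set ms \<inter> U = {}"
      "walk_edges (a # ms @ [b]) \<subseteq> E"
      and reach: "set ms \<subseteq> {(u, w). {u, w} \<in> E \<and> u \<notin> U \<and> w \<notin> U}\<^sup>* `` {y}"
      by (rule nonseparable_ear[OF graph ns UV U2 yV y(2)])
    have "w \<in> vertices_inside S" if "(y, w) \<in> {(u, w). {u, w} \<in> E \<and> u \<notin> U \<and> w \<notin> U}\<^sup>*" for w
      using that
    proof induction
      case base
      show ?case using edges_inside_vertex[OF S e y] .
    next
      case (step u w)
      then have "{u, w} \<in> edges_inside S" using vertices_inside_edge[of "{u, w}" u] by auto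
      then show ?case using edges_inside_vertex[OF S, of "{u, w}" w] step.hyps by simp
    qed
    then have ins: "set ms \<subseteq> vertices_inside S" using reach by blast
    obtain m ms' where m: "ms = m # ms'" using ear(5) by (cases ms) auto
    then have "{a, m} \<in> walk_edges (a # ms @ [b])" by simp
    moreover have "{a, m} \<in> edges_inside S"
      using vertices_inside_edge[of "{a, m}" m] ear(7) ins m by auto
    ultimately have "walk_edges (a # ms @ [b]) \<inter> edges_inside S \<noteq> {}" by blast
    then show ?thesis by (rule that[OF ear(1-4,6) ins ear(7)])
  qed
qed

text \<open>An open edge inside \<open>S1 \<union> S2\<close> that is not in \<open>T\<close> avoids
  \<open>T\<close>, hence lies in exactly one of the two parts. The resulting partitions make the
  counts in \<open>disc_cycles\<close> additive.\<close>

lemma theta_edges_vertices: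
  assumes xy: "distinct (a # xs @ b # ys)" "xs \<noteq> [] \<or> ys \<noteq> []"
    and S1: "S1 = walk_edges (a # xs @ [b])" "S1 \<subseteq> E"
    and S2: "S2 = walk_edges (a # ys @ [b])" "S2 \<subseteq> E"
    and T: "T = walk_edges (a # ms @ [b])" "T \<subseteq> E"
    and ms: "distinct ms" "set ms \<inter> ({a, b} \<union> set xs \<union> set ys) = {}"
    and ins: "T \<inter> edges_inside (S1 \<union> S2) \<noteq> {}" and msin: "set ms \<subseteq> vertices_inside (S1 \<union> S2)"
  shows "edges_inside (S1 \<union> S2) = edges_inside (S1 \<union> T) \<union> edges_inside (S2 \<union> T) \<union> T"
    "edges_inside (S1 \<union> T) \<inter> edges_inside (S2 \<union> T) = {}"
    "vertices_inside (S1 \<union> S2) = vertices_inside (S1 \<union> T) \<union> vertices_inside (S2 \<union> T) \<union> set ms"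
    "vertices_inside (S1 \<union> T) \<inter> vertices_inside (S2 \<union> T) = {}"
    "(vertices_inside (S1 \<union> T) \<union> vertices_inside (S2 \<union> T)) \<inter> set ms = {}"
proof -
  note th = theta_inside[OF xy S1 S2 T ms ins]
  have E12: "S1 \<union> T \<subseteq> E" "S2 \<union> T \<subseteq> E" "S1 \<union> S2 \<subseteq> E" using S1 S2 T by auto
  have c12: "cycle_on (S1 \<union> S2) ({a, b} \<union> set xs \<union> set ys)" unfolding S1(1) S2(1) by (rule cycle_onI[OF xy])
  have UT: "\<Union>T = {a, b} \<union> set ms" unfolding T(1) by (subst Union_walk_edges) auto
  have abV: "a \<in> V" "b \<in> V" using UT T(2) edge_subset by blast+
  have TI: "T \<subseteq> edges_inside (S1 \<union> S2)"
  proof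
    fix e assume e: "e \<in> T"
    then have eE: "e \<in> E" using T by auto
    obtain z where z: "z \<in> path_image (g e)" "z \<notin> p ` e" using edge_interior_nonempty[OF eE] by blast
    have "z \<notin> p ` V" using z edge_vertices[OF eE] by blast
    then have "z \<noteq> p a" "z \<noteq> p b" using abV by auto
    moreover have "z \<in> support T" using z e by (auto simp: support_def)
    ultimately have "z \<in> inside (support (S1 \<union> S2))" unfolding th(6)[symmetric] by simp
    then show "e \<in> edges_inside (S1 \<union> S2)" using z eE by (auto simp: edges_inside_def)
  qed
  have sub: "edges_inside (S1 \<union> T) \<subseteq> edges_inside (S1 \<union> S2)" "edges_inside (S2 \<union> T) \<subseteq> edges_inside (S1 \<union> S2)"
    unfolding edges_inside_def th(6)[symmetric] by blast+
  show "edges_inside (S1 \<union> S2) = edges_inside (S1 \<union> T) \<union> edges_inside (S2 \<union> T) \<union> T"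
  proof (intro subset_antisym subsetI)
    fix e assume e: "e \<in> edges_inside (S1 \<union> S2)"
    then have eE: "e \<in> E" by (simp add: edges_inside_def)
    obtain z where z: "z \<in> path_image (g e)" "z \<notin> p ` e" using edge_interior_nonempty[OF eE] by blast
    show "e \<in> edges_inside (S1 \<union> T) \<union> edges_inside (S2 \<union> T) \<union> T"
    proof (cases "e \<in> T")
      case False
      have "z \<notin> support T" using edge_interior_Int_support[OF T(2) eE False] z by blast
      moreover have "z \<in> inside (support (S1 \<union> S2))" using edges_inside_interior[OF c12 E12(3) e] z by blast
      ultimately have "z \<in> inside (support (S1 \<union> T)) \<or> z \<in> inside (support (S2 \<union> T))"
        unfolding th(6)[symmetric] by blast
      then show ?thesis using z eE by (auto simp: edges_inside_def)
    qed auto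
  qed (use sub TI in blast)
  show "edges_inside (S1 \<union> T) \<inter> edges_inside (S2 \<union> T) = {}"
  proof (rule ccontr)
    assume "edges_inside (S1 \<union> T) \<inter> edges_inside (S2 \<union> T) \<noteq> {}"
    then obtain e where e: "e \<in> edges_inside (S1 \<union> T)" "e \<in> edges_inside (S2 \<union> T)" by blast
    then have "e \<in> E" by (simp add: edges_inside_def)
    then show False
      using edges_inside_interior[OF th(1) E12(1) e(1)] edges_inside_interior[OF th(2) E12(2) e(2)]
        edge_interior_nonempty[of e] th(5) by blast
  qed
  have dis: "vertices_inside (S1 \<union> T) \<inter> set ms = {}" "vertices_inside (S2 \<union> T) \<inter> set ms = {}"
    using vertices_inside_disjoint[OF th(1) E12(1)] vertices_inside_disjoint[OF th(2) E12(2)] by blast+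
  then show "(vertices_inside (S1 \<union> T) \<union> vertices_inside (S2 \<union> T)) \<inter> set ms = {}" by blast
  show "vertices_inside (S1 \<union> T) \<inter> vertices_inside (S2 \<union> T) = {}"
    using th(5) by (auto simp: vertices_inside_def)
  have vsub: "vertices_inside (S1 \<union> T) \<subseteq> vertices_inside (S1 \<union> S2)" "vertices_inside (S2 \<union> T) \<subseteq> vertices_inside (S1 \<union> S2)"
    unfolding vertices_inside_def th(6)[symmetric] by blast+
  show "vertices_inside (S1 \<union> S2) = vertices_inside (S1 \<union> T) \<union> vertices_inside (S2 \<union> T) \<union> set ms"
  proof (intro subset_antisym subsetI)
    fix v assume v: "v \<in> vertices_inside (S1 \<union> S2)"
    then have vV: "v \<in> V" and "p v \<in> inside (support (S1 \<union> S2))" by (auto simp: vertices_inside_def)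
    then consider "p v \<in> inside (support (S1 \<union> T)) \<union> inside (support (S2 \<union> T))" | "p v \<in> support T"
      unfolding th(6)[symmetric] by blast
    then show "v \<in> vertices_inside (S1 \<union> T) \<union> vertices_inside (S2 \<union> T) \<union> set ms"
    proof cases
      case 1
      then show ?thesis using vV by (auto simp: vertices_inside_def)
    next
      case 2
      then have "v \<in> {a, b} \<union> set ms" using support_vertex_iff[OF T(2) vV] UT by simp
      moreover have "v \<notin> {a, b}" using vertices_inside_disjoint[OF c12 E12(3)] v by blast
      ultimately show ?thesis by blast
    qed
  qed (use vsub msin in blast)
qed

lemma finite_edges_inside [simp]: "finite (edges_inside S)"
  by (rule finite_subset[OF _ finite_E]) (auto simp: edges_inside_def)

lemma finite_vertices_inside [simp]: "finite (vertices_inside S)"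
  by (rule finite_subset[OF _ finite_V]) (auto simp: vertices_inside_def)

text \<open>An ear has one edge more than inner vertices, which makes up for the second
  \<open>+ 1\<close> when the bounds for the two parts are added. Edges of the ear are on the
  boundary of both parts, hence covered at most once from each; this is why the boundary is
  restricted to 1.\<close>

lemma disc_cycles:
  assumes ns: "nonseparable V E" and "cycle_on S U" "S \<subseteq> E"
  shows "\<exists>F. (\<forall>C\<in>set F. \<exists>W. cycle_on C W \<and> C \<subseteq> E) \<and>
    int (length F) \<ge> int (card (edges_inside S)) - int (card (vertices_inside S)) + 1 \<and>
    (\<forall>e\<in>S. cover_count F e \<le> 1) \<and> (\<forall>e\<in>edges_inside S. cover_count F e \<le> 2) \<and>
    (\<forall>e. e \<notin> S \<union> edges_inside S \<longrightarrow> cover_count F e = 0)"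
  using assms(2,3)
proof (induction "card (edges_inside S)" arbitrary: S U rule: less_induct)
  case less
  note S = less.prems
  show ?case
  proof (cases "edges_inside S = {}")
    case True
    then show ?thesis using S by (intro exI[of _ "[S]"]) auto
  next
    case False
    obtain a ms b where ear: "a \<in> U" "b \<in> U" "a \<noteq> b" "distinct ms" "set ms \<inter> U = {}" "set ms \<subseteq> vertices_inside S"
      "walk_edges (a # ms @ [b]) \<subseteq> E" "walk_edges (a # ms @ [b]) \<inter> edges_inside S \<noteq> {}"
      by (rule inside_ear[OF ns S False])
    obtain xs ys where xy: "distinct (a # xs @ b # ys)" "xs \<noteq> [] \<or> ys \<noteq> []" and U: "U = {a, b} \<union> set xs \<union> set ys" and
      S12: "S = walk_edges (a # xs @ [b]) \<union> walk_edges (a # ys @ [b])"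
      by (rule cycle_onE[OF S(1) ear(1-3)])
    define S1 where "S1 = walk_edges (a # xs @ [b])"
    define S2 where "S2 = walk_edges (a # ys @ [b])"
    define T where "T = walk_edges (a # ms @ [b])"
    have Su: "S = S1 \<union> S2" and SE: "S1 \<subseteq> E" "S2 \<subseteq> E" and TE: "T \<subseteq> E" and SI: "S1 \<inter> S2 = {}"
      using S12 S(2) ear(7) walk_edges_Int[OF xy] by (auto simp: S1_def S2_def T_def)
    note args = xy S1_def SE(1) S2_def SE(2) T_def TE ear(4) ear(5)[unfolded U] ear(8)[folded T_def, unfolded Su]
    note th = theta_inside[OF args]
    note ev = theta_edges_vertices[OF args ear(6)[unfolded Su], folded Su]
    have E12: "S1 \<union> T \<subseteq> E" "S2 \<union> T \<subseteq> E" using SE TE by auto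
    have cT: "card T = length ms + 1"
      unfolding T_def using xy ear(4,5) U by (subst card_walk_edges) auto
    have TI: "edges_inside (S1 \<union> T) \<inter> T = {}" "edges_inside (S2 \<union> T) \<inter> T = {}"
      using edges_inside_disjoint by blast+
    have finT: "finite T" by (simp add: T_def)
    have ce: "card (edges_inside S) = card (edges_inside (S1 \<union> T)) + card (edges_inside (S2 \<union> T)) + card T"
      unfolding ev(1) using ev(2) TI finT by (simp add: card_Un_disjoint Int_Un_distrib2)
    have cv: "card (vertices_inside S) = card (vertices_inside (S1 \<union> T)) + card (vertices_inside (S2 \<union> T)) + length ms"
      unfolding ev(3) using ev(4,5) distinct_card[OF ear(4)] by (simp add: card_Un_disjoint)
    obtain F1 where F1: "\<forall>C\<in>set F1. \<exists>W. cycle_on C W \<and> C \<subseteq> E"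
      "int (length F1) \<ge> int (card (edges_inside (S1 \<union> T))) - int (card (vertices_inside (S1 \<union> T))) + 1"
      "\<forall>e\<in>S1 \<union> T. cover_count F1 e \<le> 1" "\<forall>e\<in>edges_inside (S1 \<union> T). cover_count F1 e \<le> 2"
      "\<forall>e. e \<notin> (S1 \<union> T) \<union> edges_inside (S1 \<union> T) \<longrightarrow> cover_count F1 e = 0"
      using less.hyps[OF _ th(1) E12(1)] ce cT by auto
    obtain F2 where F2: "\<forall>C\<in>set F2. \<exists>W. cycle_on C W \<and> C \<subseteq> E"
      "int (length F2) \<ge> int (card (edges_inside (S2 \<union> T))) - int (card (vertices_inside (S2 \<union> T))) + 1"
      "\<forall>e\<in>S2 \<union> T. cover_count F2 e \<le> 1" "\<forall>e\<in>edges_inside (S2 \<union> T). cover_count F2 e \<le> 2"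
      "\<forall>e. e \<notin> (S2 \<union> T) \<union> edges_inside (S2 \<union> T) \<longrightarrow> cover_count F2 e = 0"
      using less.hyps[OF _ th(2) E12(2)] ce cT by auto
    have SD: "edges_inside S \<inter> S = {}" by (rule edges_inside_disjoint)
    show ?thesis
    proof (intro exI[of _ "F1 @ F2"] conjI ballI allI impI)
      show "int (card (edges_inside S)) - int (card (vertices_inside S)) + 1 \<le> int (length (F1 @ F2))"
        using F1(2) F2(2) ce cv cT by simp
    next
      fix C assume "C \<in> set (F1 @ F2)"
      then show "\<exists>W. cycle_on C W \<and> C \<subseteq> E" using F1(1) F2(1) by auto
    next
      fix e assume e: "e \<in> S"
      then have ni: "e \<notin> edges_inside (S1 \<union> T)" "e \<notin> edges_inside (S2 \<union> T)" "e \<notin> T" using SD ev(1) by blast+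
      consider "e \<in> S1" "e \<notin> S2" | "e \<in> S2" "e \<notin> S1" using e Su SI by blast
      then show "cover_count (F1 @ F2) e \<le> 1"
      proof cases
        case 1
        then have "cover_count F1 e \<le> 1" "cover_count F2 e = 0" using F1(3) F2(5) ni by blast+
        then show ?thesis by simp
      next
        case 2
        then have "cover_count F2 e \<le> 1" "cover_count F1 e = 0" using F2(3) F1(5) ni by blast+
        then show ?thesis by simp
      qed
    next
      fix e assume e: "e \<in> edges_inside S"
      then have nS: "e \<notin> S1" "e \<notin> S2" using SD Su by blast+
      consider "e \<in> T" | "e \<in> edges_inside (S1 \<union> T)" "e \<notin> T" "e \<notin> edges_inside (S2 \<union> T)"
        | "e \<in> edges_inside (S2 \<union> T)" "e \<notin> T" "e \<notin> edges_inside (S1 \<union> T)" using e ev(1,2) TI by blast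
      then show "cover_count (F1 @ F2) e \<le> 2"
      proof cases
        case 1
        then have "cover_count F1 e \<le> 1" "cover_count F2 e \<le> 1" using F1(3) F2(3) by blast+
        then show ?thesis by simp
      next
        case 2
        then have "cover_count F1 e \<le> 2" "cover_count F2 e = 0" using F1(4) F2(5) nS by blast+
        then show ?thesis by simp
      next
        case 3
        then have "cover_count F2 e \<le> 2" "cover_count F1 e = 0" using F2(4) F1(5) nS by blast+
        then show ?thesis by simp
      qed
    next
      fix e assume e: "e \<notin> S \<union> edges_inside S"
      then have "e \<notin> (S1 \<union> T) \<union> edges_inside (S1 \<union> T)" "e \<notin> (S2 \<union> T) \<union> edges_inside (S2 \<union> T)"
        using ev(1) Su by blast+
      then have "cover_count F1 e = 0" "cover_count F2 e = 0" using F1(5) F2(5) by blast+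
      then show "cover_count (F1 @ F2) e = 0" by simp
    qed
  qed
qed

end

section \<open>Moving the graph into a disc by an inversion\<close>

lemma plane_graph_subgraph:
  assumes "plane_graph V E p g" "V' \<subseteq> V" "E' \<subseteq> E" "\<And>e. e \<in> E' \<Longrightarrow> e \<subseteq> V'"
  shows "plane_graph V' E' p g"
proof -
  interpret plane_graph V E p g by fact
  show ?thesis
  proof
    show "simple_graph V' E'"
      using assms(3,4) finite_subset[OF assms(2) finite_V] card_edge by (auto simp: simple_graph_def)
    have "path_image (g e) \<inter> p ` V' = p ` e" if e: "e \<in> E'" for e
    proof -
      have "path_image (g e) \<inter> p ` V = p ` e" using edge_vertices e assms(3) by blast
      then show ?thesis using assms(2) assms(4)[OF e] by blast
    qed
    then show "plane_drawing V' E' p g"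
      unfolding plane_drawing_def using inj_on_subset[OF inj_p assms(2)] assms(3) arc_edge ends_edge edges_Int
      by (simp add: subset_iff)
  qed
qed

text \<open>Injectivity includes the point \<open>w\<close>, where \<open>inverse 0 = 0\<close>
  supplies the one value not taken elsewhere. So an isolated vertex placed at \<open>w\<close> does
  no harm.\<close>

lemma inj_inverse_diff: "inj (\<lambda>z::complex. inverse (z - w))"
  by (auto simp: inj_def)

lemma continuous_on_inverse_diff: "w \<notin> A \<Longrightarrow> continuous_on A (\<lambda>z::complex. inverse (z - w))"
  by (auto intro!: continuous_intros)

context plane_graph
begin

lemma inverted_drawing:
  assumes "w \<notin> support E"
  shows "plane_graph V E (\<lambda>v. inverse (p v - w)) (\<lambda>e. (\<lambda>z. inverse (z - w)) \<circ> g e)"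
proof
  let ?f = "\<lambda>z::complex. inverse (z - w)"
  have inj: "inj_on ?f A" for A using inj_inverse_diff by (rule inj_on_subset) simp
  have im: "?f ` p ` A = (\<lambda>v. inverse (p v - w)) ` A" for A by auto
  show "plane_drawing V E (\<lambda>v. inverse (p v - w)) (\<lambda>e. ?f \<circ> g e)"
    unfolding plane_drawing_def
  proof (intro conjI ballI impI)
    show "inj_on (\<lambda>v. inverse (p v - w)) V"
      using comp_inj_on[OF inj_p inj] by (simp add: comp_def)
  next
    fix e assume e: "e \<in> E"
    then have "w \<notin> path_image (g e)" using assms by (auto simp: support_def)
    then have "continuous_on (path_image (g e)) ?f" by (rule continuous_on_inverse_diff)
    then have "path (?f \<circ> g e)" using arc_imp_path[OF arc_edge[OF e]] by (intro path_continuous_image)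
    moreover have "inj_on (?f \<circ> g e) {0..1}"
      using arc_edge[OF e] by (intro comp_inj_on inj) (simp add: arc_def)
    ultimately show "arc (?f \<circ> g e)" by (simp add: arc_def)
    have "{pathstart (?f \<circ> g e), pathfinish (?f \<circ> g e)} = ?f ` {pathstart (g e), pathfinish (g e)}"
      by (simp add: pathstart_compose pathfinish_compose)
    then show "{pathstart (?f \<circ> g e), pathfinish (?f \<circ> g e)} = (\<lambda>v. inverse (p v - w)) ` e"
      unfolding ends_edge[OF e] im .
    show "path_image (?f \<circ> g e) \<inter> (\<lambda>v. inverse (p v - w)) ` V = (\<lambda>v. inverse (p v - w)) ` e"
      unfolding path_image_compose im[symmetric] image_Int[OF inj_inverse_diff, symmetric] edge_vertices[OF e] ..
  next
    fix e e' assume e: "e \<in> E" "e' \<in> E" "e \<noteq> e'"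
    show "path_image (?f \<circ> g e) \<inter> path_image (?f \<circ> g e') = (\<lambda>v. inverse (p v - w)) ` (e \<inter> e')"
      unfolding path_image_compose im[symmetric] image_Int[OF inj_inverse_diff, symmetric] edges_Int[OF e] ..
  qed
qed (rule graph)

text \<open>A connected set that avoids the curve and \<open>w\<close> is mapped to one side of the
  new curve. The punctured inside has an unbounded image, because \<open>w\<close> is approached, so
  it goes outside. The old outside then goes inside, and with it all edges not in \<open>S\<close>,
  as none of them met the old inside.\<close>

lemma inverted_edges_inside:
  assumes S: "cycle_on S U" "S \<subseteq> E" and empty: "edges_inside S = {}"
    and w: "w \<in> inside (support S)"
  shows "plane_graph V E (\<lambda>v. inverse (p v - w)) (\<lambda>e. (\<lambda>z. inverse (z - w)) \<circ> g e)"
    "plane_graph.edges_inside E (\<lambda>e. (\<lambda>z. inverse (z - w)) \<circ> g e) S = E - S"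
proof -
  let ?f = "\<lambda>z::complex. inverse (z - w)"
  let ?K = "support S"
  have "w \<notin> path_image (g e)" if "e \<in> E" for e
    using empty w that by (auto simp: edges_inside_def)
  then have "w \<notin> support E" by (simp add: support_def)
  then show inv: "plane_graph V E (\<lambda>v. inverse (p v - w)) (\<lambda>e. ?f \<circ> g e)"
    by (rule inverted_drawing)
  then interpret inv: plane_graph V E "\<lambda>v. inverse (p v - w)" "\<lambda>e. ?f \<circ> g e" .
  have K': "inv.support S = ?f ` ?K"
    by (auto simp: support_def inv.support_def path_image_compose)
  note J = cycle_inside_outside[OF S] and J' = inv.cycle_inside_outside[OF S]
  have dis: "?f ` A \<inter> inv.support S = {}" if "A \<inter> ?K = {}" for A
    unfolding K' image_Int[OF inj_inverse_diff, symmetric] using that by simp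
  have side: "?f ` A \<subseteq> inside (inv.support S) \<or> ?f ` A \<subseteq> outside (inv.support S)"
    if A: "connected A" "A \<inter> ?K = {}" "w \<notin> A" for A
  proof -
    have "connected (?f ` A)" using A by (intro connected_continuous_image continuous_on_inverse_diff)
    moreover have "?f ` A \<subseteq> inside (inv.support S) \<union> outside (inv.support S)"
      using dis[OF A(2)] inside_Un_outside[of "inv.support S"] by blast
    ultimately show ?thesis
      using connectedD[of "?f ` A", OF _ J'(2,4)] inside_Int_outside[of "inv.support S"] by blast
  qed
  have "\<not> ?f ` (inside ?K - {w}) \<subseteq> inside (inv.support S)"
  proof
    assume "?f ` (inside ?K - {w}) \<subseteq> inside (inv.support S)"
    then have "bounded (?f ` (inside ?K - {w}))" using J'(6) bounded_subset by blast
    then obtain M where M: "norm (?f z) \<le> M" if "z \<in> inside ?K" "z \<noteq> w" for z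
      unfolding bounded_iff by blast
    obtain r where r: "r > 0" "ball w r \<subseteq> inside ?K" using J(2) w openE by blast
    define d where "d = min (r / 2) (1 / (\<bar>M\<bar> + 1))"
    have d: "d > 0" "d < r" "d \<le> 1 / (\<bar>M\<bar> + 1)" using r by (auto simp: d_def)
    have "w + of_real d \<in> inside ?K" using r d by (auto simp: dist_norm)
    then have "inverse d \<le> M" using M[of "w + of_real d"] d by (simp add: norm_inverse)
    moreover have "\<bar>M\<bar> + 1 \<le> inverse d" using d by (simp add: field_simps)
    ultimately show False by linarith
  qed
  moreover have "connected (inside ?K - {w})" using J(2,3) by (intro connected_open_delete) auto
  ultimately have O: "?f ` (inside ?K - {w}) \<subseteq> outside (inv.support S)"
    using side[of "inside ?K - {w}"] inside_no_overlap[of ?K] by blast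
  have out: "?f ` outside ?K \<subseteq> inside (inv.support S)"
  proof (rule ccontr)
    assume "\<not> ?thesis"
    then have out: "?f ` outside ?K \<subseteq> outside (inv.support S)"
      using side[of "outside ?K"] J(5) w inside_Int_outside[of ?K] outside_no_overlap[of ?K] by blast
    \<comment> \<open>Every \<open>z \<noteq> 0\<close> is the image of some
      \<open>y \<noteq> w\<close>, so only 0 would be left for the new inside, which is open and not
      empty.\<close>
    have "z = 0" if z: "z \<in> inside (inv.support S)" for z
    proof (rule ccontr)
      assume "z \<noteq> 0"
      define y where "y = w + inverse z"
      have y: "y \<noteq> w" "?f y = z" using \<open>z \<noteq> 0\<close> by (auto simp: y_def)
      have "y \<notin> ?K" using z y K' inside_no_overlap[of "inv.support S"] by blast
      then have "y \<in> inside ?K - {w} \<or> y \<in> outside ?K" using y(1) inside_Un_outside[of ?K] by blast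
      then have "z \<in> outside (inv.support S)" using O out y(2) by blast
      then show False using z inside_Int_outside[of "inv.support S"] by blast
    qed
    then have "inside (inv.support S) = {0}" using J'(1) by blast
    then show False using J'(2) not_open_singleton by metis
  qed
  show "inv.edges_inside S = E - S"
  proof (intro subset_antisym subsetI)
    fix e assume "e \<in> inv.edges_inside S"
    then show "e \<in> E - S" using inv.edges_inside_disjoint[of S] by (auto simp: inv.edges_inside_def)
  next
    fix e assume e: "e \<in> E - S"
    obtain z where z: "z \<in> path_image (g e)" "z \<notin> p ` e" using edge_interior_nonempty[of e] e by blast
    have "\<not> path_image (g e) - p ` e \<subseteq> inside ?K" using z e empty by (auto simp: edges_inside_def)
    then have "z \<in> outside ?K" using edge_side[OF S, of e] e z by blast
    then have "?f z \<in> inside (inv.support S)" using out by blast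
    moreover have "?f z \<in> path_image (?f \<circ> g e)" using z by (simp add: path_image_compose)
    ultimately show "e \<in> inv.edges_inside S" using e by (auto simp: inv.edges_inside_def)
  qed
qed

text \<open>On at most two vertices there would be fewer edges than vertices. So a third vertex
  exists, and an ear through it over the ends of an edge is closed by that edge.\<close>

lemma nonseparable_cycle_exists:
  assumes "nonseparable V E" "card E \<ge> card V" "V \<noteq> {}"
  obtains S U where "cycle_on S U" "S \<subseteq> E"
proof -
  have V0: "card V > 0" using assms(3) finite_V by auto
  then obtain e where e: "e \<in> E" using assms(2) by fastforce
  have V3: "card V \<ge> 3"
  proof (rule ccontr)
    assume "\<not> card V \<ge> 3"
    then have "e' = V" if "e' \<in> E" for e'
      using card_seteq[OF finite_V edge_subset[OF that]] card_edge[OF that] by simp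
    then have "E = {V}" using e by blast
    then show False using assms(2) V0 card_edge[of V] by simp
  qed
  obtain x y where xy: "e = {x, y}" "x \<noteq> y" using card_edge[OF e] by (auto simp: card_2_iff)
  have "\<not> V \<subseteq> {x, y}" using V3 xy(2) card_mono[of "{x, y}" V] by (intro notI) simp
  then obtain z where z: "z \<in> V" "z \<notin> {x, y}" by blast
  have sub: "{x, y} \<subseteq> V" using edge_subset[OF e] xy by simp
  have two: "card {x, y} \<ge> 2" using xy by simp
  obtain a ms b where ear: "a \<in> {x, y}" "b \<in> {x, y}" "a \<noteq> b" "distinct ms" "ms \<noteq> []" "set ms \<inter> {x, y} = {}"
    "walk_edges (a # ms @ [b]) \<subseteq> E"
    by (rule nonseparable_ear[OF graph assms(1) sub two z])
  have "cycle_on (walk_edges (a # ms @ [b]) \<union> walk_edges (a # [] @ [b])) ({a, b} \<union> set ms \<union> set [])"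
    using ear by (intro cycle_onI) auto
  moreover have "{a, b} \<in> E" using ear(1-3) e xy by (auto simp: insert_commute)
  ultimately show ?thesis using that ear(7) by simp
qed

text \<open>A cycle \<open>S\<close> with the fewest edges inside has none, since an ear would yield
  a better one. After the inversion all other edges lie inside \<open>S\<close>, and
  \<open>card S = card U\<close> turns the bound of \<open>disc_cycles\<close> into one for the
  whole graph. The empty side of \<open>S\<close> is not counted, hence \<open>+ 1\<close> where
  Euler's formula has \<open>+ 2\<close>.\<close>

lemma nonseparable_cycles:
  assumes ns: "nonseparable V E" and V: "V \<noteq> {}"
  shows "\<exists>F. (\<forall>C\<in>set F. \<exists>W. cycle_on C W \<and> C \<subseteq> E) \<and>
    int (length F) \<ge> int (card E) - int (card V) + 1 \<and> (\<forall>e. cover_count F e \<le> 2)"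
proof (cases "card E \<ge> card V")
  case False
  then show ?thesis by (intro exI[of _ "[]"]) simp
next
  case True
  have "\<exists>S. S \<subseteq> E \<and> (\<exists>U. cycle_on S U)" using nonseparable_cycle_exists[OF ns True V] by metis
  then obtain S where SE: "S \<subseteq> E" and "\<exists>U. cycle_on S U"
    and least: "\<And>T. T \<subseteq> E \<and> (\<exists>U. cycle_on T U) \<Longrightarrow> card (edges_inside S) \<le> card (edges_inside T)"
    using ex_has_least_nat[of "\<lambda>S. S \<subseteq> E \<and> (\<exists>U. cycle_on S U)" _ "\<lambda>S. card (edges_inside S)"] by metis
  then obtain U where S: "cycle_on S U" by blast
  have empty: "edges_inside S = {}"
  proof (rule ccontr)
    assume ne: "edges_inside S \<noteq> {}"
    obtain a ms b where ear: "a \<in> U" "b \<in> U" "a \<noteq> b" "distinct ms" "set ms \<inter> U = {}" "set ms \<subseteq> vertices_inside S"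
      "walk_edges (a # ms @ [b]) \<subseteq> E" "walk_edges (a # ms @ [b]) \<inter> edges_inside S \<noteq> {}"
      by (rule inside_ear[OF ns S SE ne])
    obtain xs ys where xy: "distinct (a # xs @ b # ys)" "xs \<noteq> [] \<or> ys \<noteq> []" and U: "U = {a, b} \<union> set xs \<union> set ys" and
      S12: "S = walk_edges (a # xs @ [b]) \<union> walk_edges (a # ys @ [b])"
      by (rule cycle_onE[OF S ear(1-3)])
    define S1 where "S1 = walk_edges (a # xs @ [b])"
    define S2 where "S2 = walk_edges (a # ys @ [b])"
    define T where "T = walk_edges (a # ms @ [b])"
    have Su: "S = S1 \<union> S2" and S1E: "S1 \<subseteq> E" and S2E: "S2 \<subseteq> E" and TE: "T \<subseteq> E"
      using S12 SE ear(7) by (auto simp: S1_def S2_def T_def)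
    note args = xy S1_def S1E S2_def S2E T_def TE ear(4) ear(5)[unfolded U] ear(8)[folded T_def, unfolded Su]
    have ev: "edges_inside S = edges_inside (S1 \<union> T) \<union> edges_inside (S2 \<union> T) \<union> T"
      using theta_edges_vertices(1)[OF args] ear(6) Su by simp
    have "edges_inside (S1 \<union> T) \<inter> T = {}" using edges_inside_disjoint[of "S1 \<union> T"] by blast
    moreover have "T \<noteq> {}" unfolding T_def by (cases ms) auto
    ultimately have "edges_inside (S1 \<union> T) \<subset> edges_inside S" unfolding ev by blast
    then have "card (edges_inside (S1 \<union> T)) < card (edges_inside S)" by (intro psubset_card_mono) auto
    moreover have "card (edges_inside S) \<le> card (edges_inside (S1 \<union> T))"
      using least[of "S1 \<union> T"] theta_inside(1)[OF args] S1E TE by blast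
    ultimately show False by simp
  qed
  obtain w where w: "w \<in> inside (support S)" using cycle_inside_outside(1)[OF S SE] by blast
  let ?p = "\<lambda>v. inverse (p v - w)" and ?g = "\<lambda>e. (\<lambda>z. inverse (z - w)) \<circ> g e"
  interpret inv: plane_graph V E ?p ?g by (rule inverted_edges_inside(1)[OF S SE empty w])
  have ins: "inv.edges_inside S = E - S" by (rule inverted_edges_inside(2)[OF S SE empty w])
  obtain F where F: "\<forall>C\<in>set F. \<exists>W. cycle_on C W \<and> C \<subseteq> E"
    "int (length F) \<ge> int (card (inv.edges_inside S)) - int (card (inv.vertices_inside S)) + 1"
    "\<forall>e\<in>S. cover_count F e \<le> 1" "\<forall>e\<in>inv.edges_inside S. cover_count F e \<le> 2"
    "\<forall>e. e \<notin> S \<union> inv.edges_inside S \<longrightarrow> cover_count F e = 0"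
    using inv.disc_cycles[OF ns S SE] by metis
  have "cover_count F e \<le> 2" for e
  proof -
    consider "e \<in> S" | "e \<in> inv.edges_inside S" | "e \<notin> S \<union> inv.edges_inside S" by blast
    then show ?thesis
    proof cases
      case 1
      then have "cover_count F e \<le> 1" using F(3) by blast
      then show ?thesis by simp
    next
      case 2
      then show ?thesis using F(4) by blast
    next
      case 3
      then have "cover_count F e = 0" using F(5) by blast
      then show ?thesis by simp
    qed
  qed
  moreover have "int (card E) - int (card V) + 1 \<le> int (length F)"
  proof -
    have "card (inv.vertices_inside S) \<le> card (V - U)"
      using inv.vertices_inside_disjoint[OF S SE] finite_V
      by (intro card_mono) (auto simp: inv.vertices_inside_def)
    moreover have "card (V - U) = card V - card U" "card U \<le> card V"
      using cycle_subset_V[OF S SE] finite_V by (auto intro: card_mono card_Diff_subset finite_subset)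
    moreover have "card (E - S) = card E - card S" "card S \<le> card E"
      using SE finite_E by (auto intro: card_mono card_Diff_subset finite_subset)
    moreover have "card S = card U" by (rule card_cycle_on(1)[OF S])
    ultimately show ?thesis using F(2) ins by simp
  qed
  ultimately show ?thesis using F(1) by blast
qed

end

section \<open>Gluing along separations of order at most one\<close>

lemma cover_count_eq_0: "(\<And>C. C \<in> set F \<Longrightarrow> e \<notin> C) \<Longrightarrow> cover_count F e = 0"
  by (induction F) auto

text \<open>A separation counts at most one vertex twice, and each side brings its own
  \<open>+ 1\<close>, so the two bounds add up. This covers graphs with cut vertices or several
  components, whose faces need not be bounded by cycles.\<close>

theorem plane_graph_cycles:
  assumes "plane_graph V E p g" "V \<noteq> {}"
  shows "\<exists>F. (\<forall>C\<in>set F. \<exists>W. cycle_on C W \<and> C \<subseteq> E) \<and>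
    int (length F) \<ge> int (card E) - int (card V) + 1 \<and> (\<forall>e. cover_count F e \<le> 2)"
  using assms
proof (induction "card V" arbitrary: V E rule: less_induct)
  case less
  interpret plane_graph V E p g by fact
  show ?case
  proof (cases "nonseparable V E")
    case True
    then show ?thesis using less.prems(2) by (rule nonseparable_cycles)
  next
    case False
    then obtain V1 V2 where V12: "V1 \<union> V2 = V" "card (V1 \<inter> V2) \<le> 1" "\<forall>e\<in>E. e \<subseteq> V1 \<or> e \<subseteq> V2"
      "V1 \<noteq> V" "V2 \<noteq> V" unfolding nonseparable_def by blast
    define E1 where "E1 = {e \<in> E. e \<subseteq> V1}"
    \<comment> \<open>The complement makes the two edge sets a partition, so no edge is covered from
      both sides.\<close>
    define E2 where "E2 = E - E1"
    have sub: "V1 \<subseteq> V" "V2 \<subseteq> V" using V12(1) by auto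
    have fin: "finite V1" "finite V2" using sub finite_V finite_subset by auto
    have ne: "V1 \<noteq> {}" "V2 \<noteq> {}" using V12 by auto
    have "card V1 < card V" "card V2 < card V" using sub V12(4,5) finite_V by (auto intro: psubset_card_mono)
    moreover have "plane_graph V1 E1 p g"
      using less.prems(1) sub(1) by (rule plane_graph_subgraph) (auto simp: E1_def)
    moreover have "plane_graph V2 E2 p g"
      using less.prems(1) sub(2) by (rule plane_graph_subgraph) (use V12(3) in \<open>auto simp: E1_def E2_def\<close>)
    ultimately obtain F1 F2 where F1: "\<forall>C\<in>set F1. \<exists>W. cycle_on C W \<and> C \<subseteq> E1"
      "int (length F1) \<ge> int (card E1) - int (card V1) + 1" "\<forall>e. cover_count F1 e \<le> 2"
      and F2: "\<forall>C\<in>set F2. \<exists>W. cycle_on C W \<and> C \<subseteq> E2"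
      "int (length F2) \<ge> int (card E2) - int (card V2) + 1" "\<forall>e. cover_count F2 e \<le> 2"
      using less.hyps ne by metis
    have "cover_count (F1 @ F2) e \<le> 2" for e
    proof (cases "e \<in> E1")
      case True
      then have "cover_count F2 e = 0" using F2(1) by (intro cover_count_eq_0) (auto simp: E2_def)
      then show ?thesis using F1(3) by simp
    next
      case False
      then have "cover_count F1 e = 0" using F1(1) by (intro cover_count_eq_0) auto
      then show ?thesis using F2(3) by simp
    qed
    moreover have "int (card E) - int (card V) + 1 \<le> int (length (F1 @ F2))"
    proof -
      have "card V1 + card V2 = card V + card (V1 \<inter> V2)" using card_Un_Int[OF fin] V12(1) by simp
      moreover have "card E = card E1 + card E2"
        using card_Un_disjoint[of E1 E2] finite_E by (auto simp: E1_def E2_def Un_absorb1)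
      ultimately show ?thesis using F1(2) F2(2) V12(2) by simp
    qed
    moreover have "\<forall>C\<in>set (F1 @ F2). \<exists>W. cycle_on C W \<and> C \<subseteq> E"
      using F1(1) F2(1) by (auto simp: E1_def E2_def)
    ultimately show ?thesis by blast
  qed
qed

section \<open>Discharging\<close>

lemma sum_list_card_Int:
  assumes "finite A"
  shows "(\<Sum>C\<leftarrow>F. card (C \<inter> A)) = (\<Sum>e\<in>A. cover_count F e)"
proof (induction F)
  case (Cons C F)
  have "card (C \<inter> A) = (\<Sum>e\<in>A. if e \<in> C then 1 else 0)"
    using assms by (simp add: sum.If_cases Int_commute)
  then show ?case using Cons by (simp add: sum.distrib)
qed simp

lemma sum_list_card_filter:
  assumes "finite A"
  shows "(\<Sum>C\<leftarrow>F. card {v \<in> A. P C v}) = (\<Sum>v\<in>A. length (filter (\<lambda>C. P C v) F))"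
proof (induction F)
  case (Cons C F)
  have "card {v \<in> A. P C v} = (\<Sum>v\<in>A. if P C v then 1 else 0)"
    using assms by (simp add: sum.If_cases Int_def)
  moreover have "length (filter (\<lambda>C. P C v) (C # F)) = (if P C v then 1 else 0) + length (filter (\<lambda>C. P C v) F)" for v
    by simp
  ultimately show ?case using Cons by (simp only: sum.distrib sum_list.Cons list.map)
qed simp

lemma sum_card_incident:
  assumes "finite A" "finite M"
  shows "(\<Sum>v\<in>M. card {e \<in> A. v \<in> e}) = (\<Sum>e\<in>A. card (e \<inter> M))"
proof -
  have "(\<Sum>v\<in>M. card {e \<in> A. v \<in> e}) = (\<Sum>v\<in>M. \<Sum>e\<in>A. if v \<in> e then 1 else 0)"
    using assms by (simp add: sum.If_cases Int_def)
  also have "\<dots> = (\<Sum>e\<in>A. \<Sum>v\<in>M. if v \<in> e then 1 else 0)" by (rule sum.swap)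
  also have "\<dots> = (\<Sum>e\<in>A. card (e \<inter> M))"
    using assms by (simp add: sum.If_cases Int_commute)
  finally show ?thesis .
qed

lemma triangle_free_cycle:
  assumes "triangle_free E" "cycle_on S U" "S \<subseteq> E"
  shows "card S \<ge> 4"
proof (rule ccontr)
  assume "\<not> card S \<ge> 4"
  then have "card U = 3" using card_cycle_on[OF assms(2)] by simp
  obtain zs where zs: "distinct zs" "set zs = U" "S = walk_edges (zs @ [hd zs])"
    using assms(2) unfolding cycle_on_def by blast
  then have "length zs = 3" using \<open>card U = 3\<close> distinct_card by fastforce
  then obtain x y z where "zs = [x, y, z]" by (auto simp: numeral_3_eq_3 length_Suc_conv)
  then have "{x, y} \<in> E" "{y, z} \<in> E" "{x, z} \<in> E" using zs(3) assms(3) by (auto simp: insert_commute)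
  then show False using assms(1) unfolding triangle_free_def by blast
qed

definition nbhd :: "'a set set \<Rightarrow> 'a set \<Rightarrow> 'a \<Rightarrow> 'a set" where
  "nbhd E M u = {x \<in> M. {u, x} \<in> E}"

text \<open>
  \<open>C2\<close> contains one vertex for each pair of vertices of \<open>M\<close> that is the neighbourhood in \<open>M\<close> of a vertex
  outside of \<open>M\<close>.
\<close>

locale reduced_graph = plane_graph V E p g for V :: "'a set" and E p g +
  fixes M C2 :: "'a set"
  assumes triangle_free: "triangle_free E"
    and M: "M \<subseteq> V" "M \<noteq> {}"
    and C2: "C2 \<subseteq> {u \<in> V - M. card (nbhd E M u) = 2}" "inj_on (nbhd E M) C2"
      "nbhd E M ` C2 = nbhd E M ` {u \<in> V - M. card (nbhd E M u) = 2}"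
    and few: "\<And>u. u \<in> V - M \<Longrightarrow> card (nbhd E M u) \<le> 3"
begin

abbreviation "N \<equiv> nbhd E M"

section \<open>The graph on \<open>M\<close> and the kept eliminated vertices\<close>

definition "C3 = {u \<in> V - M. card (N u) = 3}"

definition star :: "'a set \<Rightarrow> 'a set set" where
  "star D = (\<lambda>(u, x). {u, x}) ` (SIGMA u:D. N u)"

definition "EM = {e \<in> E. e \<subseteq> M}"

text \<open>Edges between eliminated vertices are dropped, so every vertex of \<open>C2\<close> has
  degree exactly 2. Eliminated vertices with at most one neighbour in \<open>M\<close> cause no
  conflict and are left out.\<close>

definition "VK = M \<union> C3 \<union> C2"
definition "EK = EM \<union> star C3 \<union> star C2"

lemma N_subset: "N u \<subseteq> M" and N_edge: "x \<in> N u \<Longrightarrow> {u, x} \<in> E"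
  by (auto simp: nbhd_def)

lemma finite_M: "finite M" using M(1) finite_V by (rule finite_subset)
lemma finite_N: "finite (N u)" using N_subset finite_M by (rule finite_subset)

lemma outside: "u \<in> C3 \<Longrightarrow> u \<in> V - M" "u \<in> C2 \<Longrightarrow> u \<in> V - M"
  and card_N: "u \<in> C3 \<Longrightarrow> card (N u) = 3" "u \<in> C2 \<Longrightarrow> card (N u) = 2"
  using C2(1) by (auto simp: C3_def)

lemma sub_outside: "C3 \<subseteq> V - M" "C2 \<subseteq> V - M"
  using outside by auto

lemma C2_C3_disjoint: "C2 \<inter> C3 = {}" using card_N by fastforce

lemma finite_C: "finite C3" "finite C2"
  using sub_outside finite_V by (auto intro: finite_subset)

lemma star_iff: "e \<in> star D \<longleftrightarrow> (\<exists>u\<in>D. \<exists>x\<in>N u. e = {u, x})"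
  by (auto simp: star_def)

lemma star_Int_M: "D \<subseteq> V - M \<Longrightarrow> e \<in> star D \<Longrightarrow> card (e \<inter> M) = 1"
proof -
  assume D: "D \<subseteq> V - M" and "e \<in> star D"
  then obtain u x where ux: "u \<in> D" "x \<in> N u" "e = {u, x}" by (auto simp: star_iff)
  then have "e \<inter> M = {x}" using D N_subset by auto
  then show ?thesis by simp
qed

lemma star_subset: "D \<subseteq> V \<Longrightarrow> star D \<subseteq> E"
  using N_edge by (auto simp: star_iff)

lemma finite_star: "finite D \<Longrightarrow> finite (star D)"
  using finite_N by (auto simp: star_def)

lemma card_star:
  assumes "D \<subseteq> V - M" "finite D"
  shows "card (star D) = (\<Sum>u\<in>D. card (N u))"
proof -
  have "inj_on (\<lambda>(u, x). {u, x}) (SIGMA u:D. N u)"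
    using assms(1) N_subset by (fastforce simp: inj_on_def doubleton_eq_iff)
  then have "card (star D) = card (SIGMA u:D. N u)" unfolding star_def by (rule card_image)
  then show ?thesis using assms(2) finite_N by simp
qed

lemma card_star_at:
  assumes "D \<subseteq> V - M" "v \<in> M"
  shows "card {e \<in> star D. v \<in> e} = card {u \<in> D. v \<in> N u}"
proof -
  have "{e \<in> star D. v \<in> e} = (\<lambda>u. {u, v}) ` {u \<in> D. v \<in> N u}"
  proof (intro subset_antisym subsetI)
    fix e assume "e \<in> {e \<in> star D. v \<in> e}"
    then obtain u x where ux: "u \<in> D" "x \<in> N u" "e = {u, x}" "v \<in> e" by (auto simp: star_iff)
    then have "v = x" using assms by auto
    then show "e \<in> (\<lambda>u. {u, v}) ` {u \<in> D. v \<in> N u}" using ux by auto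
  qed (auto simp: star_iff)
  moreover have "inj_on (\<lambda>u. {u, v}) {u \<in> D. v \<in> N u}" by (auto simp: inj_on_def doubleton_eq_iff)
  ultimately show ?thesis by (simp add: card_image)
qed

lemma finite_EM: "finite EM" using finite_E by (simp add: EM_def)

lemma card_EM_at:
  assumes "v \<in> M"
  shows "card {e \<in> EM. v \<in> e} = card (N v)"
proof -
  have "{e \<in> EM. v \<in> e} = (\<lambda>x. {v, x}) ` N v"
  proof (intro subset_antisym subsetI)
    fix e assume e: "e \<in> {e \<in> EM. v \<in> e}"
    then obtain x y where "e = {x, y}" using card_edge[of e] by (auto simp: EM_def card_2_iff)
    then obtain x where "e = {v, x}" using e by (auto simp: insert_commute)
    then show "e \<in> (\<lambda>x. {v, x}) ` N v" using e by (auto simp: EM_def nbhd_def)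
  qed (use assms in \<open>auto simp: EM_def nbhd_def\<close>)
  moreover have "inj_on (\<lambda>x. {v, x}) (N v)" by (auto simp: inj_on_def doubleton_eq_iff)
  ultimately show ?thesis by (simp add: card_image)
qed

lemma EK_parts_disjoint: "(EM \<union> star C3) \<inter> star C2 = {}" "EM \<inter> star C3 = {}"
proof -
  have "e \<notin> EM" if "e \<in> star D" "D \<subseteq> V - M" for e D
    using that by (auto simp: star_iff EM_def)
  moreover have "e \<notin> star C3" if e2: "e \<in> star C2" for e
  proof
    assume "e \<in> star C3"
    then obtain u x where ux: "u \<in> C3" "x \<in> N u" "e = {u, x}" unfolding star_iff by blast
    obtain u' x' where ux': "u' \<in> C2" "x' \<in> N u'" "e = {u', x'}" using e2 unfolding star_iff by blast
    have "u \<notin> M" "u' \<notin> M" "x \<in> M" "x' \<in> M"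
      using outside(1)[OF ux(1)] outside(2)[OF ux'(1)] ux(2) ux'(2) N_subset by auto
    then have "u = u'" using ux(3) ux'(3) by (auto simp: doubleton_eq_iff)
    then show False using C2_C3_disjoint ux(1) ux'(1) by blast
  qed
  ultimately show "(EM \<union> star C3) \<inter> star C2 = {}" "EM \<inter> star C3 = {}"
    using sub_outside by blast+
qed

lemma EK_subset: "EK \<subseteq> E"
  using star_subset sub_outside by (auto simp: EK_def EM_def)

lemma plane_graph_K: "plane_graph VK EK p g"
proof (rule plane_graph_subgraph)
  show "plane_graph V E p g" by unfold_locales
  show "VK \<subseteq> V" using M(1) sub_outside by (auto simp: VK_def)
  show "EK \<subseteq> E" by (rule EK_subset)
  fix e assume "e \<in> EK"
  then show "e \<subseteq> VK" using N_subset by (auto simp: EK_def VK_def EM_def star_iff)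
qed

text \<open>A cycle has two edges or none at a vertex, so 2 means that it both enters and leaves
  \<open>v\<close> by way of \<open>C2\<close>.\<close>

definition corner :: "'a set set \<Rightarrow> 'a \<Rightarrow> bool" where
  "corner C v \<longleftrightarrow> card {e \<in> C. v \<in> e \<and> e \<in> star C2} = 2"

lemma EK_at_C2:
  assumes "u \<in> C2"
  shows "{e \<in> EK. u \<in> e} = (\<lambda>x. {u, x}) ` N u"
proof (intro subset_antisym subsetI)
  fix e assume e: "e \<in> {e \<in> EK. u \<in> e}"
  have uM: "u \<notin> M" using outside(2)[OF assms] by simp
  then have "e \<notin> EM" using e by (auto simp: EM_def)
  then obtain w x where wx: "w \<in> C3 \<union> C2" "x \<in> N w" "e = {w, x}" using e by (auto simp: EK_def star_iff)
  then have "w = u" using e uM N_subset by auto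
  then show "e \<in> (\<lambda>x. {u, x}) ` N u" using wx by auto
next
  fix e assume "e \<in> (\<lambda>x. {u, x}) ` N u"
  then show "e \<in> {e \<in> EK. u \<in> e}" using assms by (auto simp: EK_def star_iff)
qed

text \<open>The vertex has only two edges, and the cycle uses both.\<close>

lemma cycle_at_C2:
  assumes "cycle_on C U" "C \<subseteq> EK" "u \<in> C2" "u \<in> U" "x \<in> N u"
  shows "x \<in> U"
proof -
  have inj: "inj_on (\<lambda>x. {u, x}) (N u)" by (auto simp: inj_on_def doubleton_eq_iff)
  have "card {e \<in> EK. u \<in> e} = 2" "finite {e \<in> EK. u \<in> e}"
    using card_N(2)[OF assms(3)] finite_N unfolding EK_at_C2[OF assms(3)] card_image[OF inj] by auto
  moreover have "card {e \<in> C. u \<in> e} = 2" using cycle_on_degree[OF assms(1), of u] assms(4) by simp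
  moreover have "{e \<in> C. u \<in> e} \<subseteq> {e \<in> EK. u \<in> e}" using assms(2) by blast
  ultimately have "{e \<in> C. u \<in> e} = {e \<in> EK. u \<in> e}" by (intro card_subset_eq) auto
  then have "{e \<in> C. u \<in> e} = (\<lambda>x. {u, x}) ` N u" using EK_at_C2[OF assms(3)] by simp
  then have "{u, x} \<in> C" using assms(5) by blast
  then show "x \<in> U" using card_cycle_on(5)[OF assms(1)] by blast
qed

text \<open>The two neighbours \<open>u\<close>, \<open>u'\<close> of \<open>v\<close> on the cycle
  represent different pairs \<open>{v, w}\<close> and \<open>{v, w'}\<close>, so the cycle has the
  five vertices \<open>u\<close>, \<open>u'\<close>, \<open>v\<close>, \<open>w\<close>,
  \<open>w'\<close>. Two representatives of the same pair could close a cycle of length 4.\<close>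

lemma corner_length:
  assumes C: "cycle_on C U" "C \<subseteq> EK" and v: "v \<in> M" "corner C v"
  shows "card C \<ge> 5"
proof -
  obtain e e' where e: "e \<noteq> e'" "{x \<in> C. v \<in> x \<and> x \<in> star C2} = {e, e'}"
    using v(2) unfolding corner_def card_2_iff by blast
  then have e2: "e \<in> C" "v \<in> e" "e \<in> star C2" "e' \<in> C" "v \<in> e'" "e' \<in> star C2" by blast+
  obtain u x where u: "u \<in> C2" "x \<in> N u" "e = {u, x}" using e2(3) by (auto simp: star_iff)
  obtain u' x' where u': "u' \<in> C2" "x' \<in> N u'" "e' = {u', x'}" using e2(6) by (auto simp: star_iff)
  have nM: "u \<notin> M" "u' \<notin> M" using outside(2) u(1) u'(1) by auto
  have "x = v" "x' = v" using e2(2,5) u(3) u'(3) v(1) nM by auto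
  then have "u \<noteq> u'" using e(1) u(3) u'(3) by auto
  then have Nne: "N u \<noteq> N u'" using C2(2) u(1) u'(1) by (auto dest: inj_onD)
  have vN: "v \<in> N u" "v \<in> N u'" using u u' \<open>x = v\<close> \<open>x' = v\<close> by auto
  have other: "\<exists>w. A = {v, w} \<and> w \<noteq> v" if A: "card A = 2" "v \<in> A" for A
  proof -
    obtain y z where "A = {y, z}" "y \<noteq> z" using A(1) by (auto simp: card_2_iff)
    then show ?thesis using A(2) by (cases "v = y") (auto simp: insert_commute)
  qed
  obtain w where w: "N u = {v, w}" "w \<noteq> v"
    using other[OF card_N(2)[OF u(1)] vN(1)] by blast
  obtain w' where w': "N u' = {v, w'}" "w' \<noteq> v"
    using other[OF card_N(2)[OF u'(1)] vN(2)] by blast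
  have "w \<noteq> w'" using Nne w w' by auto
  have wM: "w \<in> M" "w' \<in> M" using N_subset[of u] N_subset[of u'] w w' by auto
  have U: "\<Union>C = U" by (rule card_cycle_on(5)[OF C(1)])
  have uU: "u \<in> U" "u' \<in> U" "v \<in> U" using e2 u u' U by blast+
  have "w \<in> U" "w' \<in> U"
    using cycle_at_C2[OF C u(1) uU(1)] cycle_at_C2[OF C u'(1) uU(2)] w w' by auto
  then have "{u, u', v, w, w'} \<subseteq> U" using uU by auto
  moreover have "card {u, u', v, w, w'} = 5"
    using \<open>u \<noteq> u'\<close> \<open>w \<noteq> w'\<close> w(2) w'(2) nM wM v(1) by (auto simp: card_insert_if)
  ultimately show ?thesis using card_mono[of U] card_cycle_on(1,2)[OF C(1)] by metis
qed

text \<open>A corner occupies two edges of \<open>star C2\<close>, and such an edge has only one end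
  in \<open>M\<close>, so different corners occupy different edges.\<close>

lemma corners_length:
  assumes C: "cycle_on C U" "C \<subseteq> EK"
  shows "2 * card {v \<in> M. corner C v} \<le> card C"
proof -
  let ?T = "{v \<in> M. corner C v}" and ?A = "\<lambda>v. {e \<in> C. v \<in> e \<and> e \<in> star C2}"
  have fin: "finite C" by (rule card_cycle_on(3)[OF C(1)])
  have disj: "?A v \<inter> ?A w = {}" if "v \<in> M" "w \<in> M" "v \<noteq> w" for v w
  proof (rule ccontr)
    assume "?A v \<inter> ?A w \<noteq> {}"
    then obtain e where e: "v \<in> e" "w \<in> e" "e \<in> star C2" by blast
    have "e \<inter> M = {v} \<or> card (e \<inter> M) \<noteq> 1" using e(1) that(1) by (metis IntI card_1_singletonE singletonD)
    then show False using star_Int_M[OF sub_outside(2) e(3)] e(2) that by auto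
  qed
  have "2 * card ?T = (\<Sum>v\<in>?T. card (?A v))" by (simp add: corner_def)
  also have "\<dots> = card (\<Union>v\<in>?T. ?A v)"
    using fin finite_M disj by (intro card_UN_disjoint[symmetric]) auto
  also have "\<dots> \<le> card C" using fin by (intro card_mono) auto
  finally show ?thesis .
qed

text \<open>Without corners this is triangle-freeness. Otherwise the length is at least 5 and at
  least twice the number of corners; for length 5 the bound is met with equality by two corners, and
  it is integrality that excludes more.\<close>

lemma cycle_length:
  assumes C: "cycle_on C U" "C \<subseteq> EK"
  shows "8 + card {v \<in> M. corner C v} \<le> 2 * card C"
proof (cases "{v \<in> M. corner C v} = {}")
  case True
  have "card C \<ge> 4" using C(2) EK_subset by (intro triangle_free_cycle[OF triangle_free C(1)]) blast
  then show ?thesis unfolding True by simp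
next
  case False
  then have "card C \<ge> 5" using corner_length[OF C] by blast
  then show ?thesis using corners_length[OF C] by linarith
qed

text \<open>A cycle through \<open>v\<close> that uses an edge to \<open>C2\<close> but has no
  corner at \<open>v\<close> uses exactly one other edge there, from \<open>EM\<close> or
  \<open>star C3\<close>.\<close>

lemma cycle_degree_at:
  assumes C: "cycle_on C U" "C \<subseteq> EK"
  shows "card (C \<inter> {e \<in> star C2. v \<in> e}) \<le> (if corner C v then 2 else 0) + card (C \<inter> {e \<in> EM \<union> star C3. v \<in> e})"
proof -
  have fin: "finite C" by (rule card_cycle_on(3)[OF C(1)])
  let ?A = "C \<inter> {e \<in> star C2. v \<in> e}" and ?B = "C \<inter> {e \<in> EM \<union> star C3. v \<in> e}"
  have "{e \<in> C. v \<in> e} = ?A \<union> ?B" using C(2) by (auto simp: EK_def)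
  moreover have "card (?A \<union> ?B) = card ?A + card ?B"
    using fin EK_parts_disjoint(1) by (intro card_Un_disjoint) auto
  moreover have "card {e \<in> C. v \<in> e} = 2 \<or> card {e \<in> C. v \<in> e} = 0" using cycle_on_degree[OF C(1), of v] by simp
  ultimately have "card ?A + card ?B = 2 \<or> card ?A + card ?B = 0" by simp
  moreover have "corner C v \<longleftrightarrow> card ?A = 2"
    unfolding corner_def by (rule arg_cong[where f = "\<lambda>X. card X = 2"]) blast
  ultimately show ?thesis by auto
qed

section \<open>Degrees and the weights of the vertices\<close>

definition "d1 v = card (N v)"
definition "d2 v = card {u \<in> C2. v \<in> N u}"
definition "d3 v = card {u \<in> C3. v \<in> N u}"

lemma sum_d:
  "(\<Sum>v\<in>M. d1 v) = 2 * card EM" "(\<Sum>v\<in>M. d3 v) = 3 * card C3" "card (star C3) = 3 * card C3"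
  "card (star C2) = 2 * card C2"
proof -
  have "(\<Sum>v\<in>M. d1 v) = (\<Sum>v\<in>M. card {e \<in> EM. v \<in> e})" by (simp add: d1_def card_EM_at)
  also have "\<dots> = (\<Sum>e\<in>EM. card (e \<inter> M))" by (rule sum_card_incident[OF finite_EM finite_M])
  also have "\<dots> = (\<Sum>e\<in>EM. 2)" by (rule sum.cong) (auto simp: EM_def Int_absorb2 card_edge)
  finally show "(\<Sum>v\<in>M. d1 v) = 2 * card EM" by simp
  show c3: "card (star C3) = 3 * card C3"
    unfolding card_star[OF sub_outside(1) finite_C(1)] using card_N by simp
  show "card (star C2) = 2 * card C2"
    unfolding card_star[OF sub_outside(2) finite_C(2)] using card_N by simp
  have "(\<Sum>v\<in>M. d3 v) = (\<Sum>v\<in>M. card {e \<in> star C3. v \<in> e})"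
    by (simp add: d3_def card_star_at[OF sub_outside(1)])
  also have "\<dots> = (\<Sum>e\<in>star C3. card (e \<inter> M))"
    by (rule sum_card_incident[OF finite_star[OF finite_C(1)] finite_M])
  also have "\<dots> = card (star C3)" using star_Int_M[OF sub_outside(1)] by simp
  finally show "(\<Sum>v\<in>M. d3 v) = 3 * card C3" using c3 by simp
qed

text \<open>The weights \<open>3 * P v + 6 * d1 v + 4 * d3 v - 24\<close> have a negative sum. A
  vertex of negative weight satisfies the first bound since \<open>P v \<ge> 0\<close> and the
  second since \<open>P v \<ge> d2 v - d1 v - d3 v\<close>. Edges may be covered less than twice, so
  the shortfalls \<open>2 - ?c e\<close> are carried along.\<close>

lemma discharging:
  "\<exists>v\<in>M. 3 * d1 v + 2 * d3 v < 12 \<and> 3 * d1 v + d3 v + 3 * d2 v < 24"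
proof -
  have "VK \<noteq> {}" using M(2) by (auto simp: VK_def)
  then obtain F where F: "\<forall>C\<in>set F. \<exists>W. cycle_on C W \<and> C \<subseteq> EK"
    "int (length F) \<ge> int (card EK) - int (card VK) + 1" "\<forall>e. cover_count F e \<le> 2"
    using plane_graph_cycles[OF plane_graph_K] by metis
  define T where "T v = length (filter (\<lambda>C. corner C v) F)" for v
  let ?c = "\<lambda>e. int (cover_count F e)"
  have fin: "finite EM" "finite (star C3)" "finite (star C2)"
    using finite_EM finite_star finite_C by auto
  have finEK: "finite EK" using fin by (simp add: EK_def)
  have cardEK: "card EK = card EM + 3 * card C3 + 2 * card C2"
    using EK_parts_disjoint fin by (simp add: EK_def card_Un_disjoint sum_d)
  have "(M \<union> C3) \<inter> C2 = {}" "M \<inter> C3 = {}" using sub_outside C2_C3_disjoint by blast+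
  then have cardVK: "card VK = card M + card C3 + card C2"
    using finite_M finite_C by (simp add: VK_def card_Un_disjoint)
  have total: "8 * int (length F) + (\<Sum>v\<in>M. int (T v)) \<le> 2 * (\<Sum>e\<in>EK. ?c e)"
  proof -
    have "(\<Sum>C\<leftarrow>F. 8 + card {v \<in> M. corner C v}) \<le> (\<Sum>C\<leftarrow>F. 2 * card (C \<inter> EK))"
    proof (rule sum_list_mono)
      fix C assume "C \<in> set F"
      then obtain W where C: "cycle_on C W" "C \<subseteq> EK" using F(1) by blast
      then have "C \<inter> EK = C" by blast
      then show "8 + card {v \<in> M. corner C v} \<le> 2 * card (C \<inter> EK)" using cycle_length[OF C] by simp
    qed
    moreover have "(\<Sum>C\<leftarrow>F. 8 + card {v \<in> M. corner C v}) = 8 * length F + (\<Sum>v\<in>M. T v)"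
      unfolding sum_list_addf sum_list_card_filter[OF finite_M] T_def by (simp add: sum_list_triv)
    moreover have "(\<Sum>C\<leftarrow>F. 2 * card (C \<inter> EK)) = 2 * (\<Sum>e\<in>EK. cover_count F e)"
      unfolding sum_list_const_mult sum_list_card_Int[OF finEK] ..
    ultimately have "8 * length F + (\<Sum>v\<in>M. T v) \<le> 2 * (\<Sum>e\<in>EK. cover_count F e)" by simp
    then have "int (8 * length F + (\<Sum>v\<in>M. T v)) \<le> int (2 * (\<Sum>e\<in>EK. cover_count F e))"
      by (rule of_nat_mono)
    then show ?thesis by simp
  qed
  have local: "(\<Sum>e | e \<in> star C2 \<and> v \<in> e. ?c e) \<le> 2 * int (T v) + 2 * (int (d1 v) + int (d3 v))" if v: "v \<in> M" for v
  proof -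
    let ?A = "{e \<in> star C2. v \<in> e}" and ?B = "{e \<in> EM \<union> star C3. v \<in> e}"
    have "(\<Sum>C\<leftarrow>F. card (C \<inter> ?A)) \<le> (\<Sum>C\<leftarrow>F. (if corner C v then 2 else 0) + card (C \<inter> ?B))"
    proof (rule sum_list_mono)
      fix C assume "C \<in> set F"
      then obtain W where C: "cycle_on C W" "C \<subseteq> EK" using F(1) by blast
      show "card (C \<inter> ?A) \<le> (if corner C v then 2 else 0) + card (C \<inter> ?B)" by (rule cycle_degree_at[OF C])
    qed
    also have "\<dots> = 2 * T v + (\<Sum>C\<leftarrow>F. card (C \<inter> ?B))"
    proof -
      have "(\<Sum>C\<leftarrow>F. if corner C v then 2 else 0) = 2 * T v" unfolding T_def by (induction F) auto
      then show ?thesis unfolding sum_list_addf by simp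
    qed
    finally have "(\<Sum>e\<in>?A. cover_count F e) \<le> 2 * T v + (\<Sum>e\<in>?B. cover_count F e)"
      using fin by (simp add: sum_list_card_Int)
    also have "(\<Sum>e\<in>?B. cover_count F e) \<le> (\<Sum>e\<in>?B. 2)" using F(3) by (intro sum_mono) blast
    also have "\<dots> = 2 * (d1 v + d3 v)"
    proof -
      have "?B = {e \<in> EM. v \<in> e} \<union> {e \<in> star C3. v \<in> e}" by blast
      then have "card ?B = card {e \<in> EM. v \<in> e} + card {e \<in> star C3. v \<in> e}"
        using fin EK_parts_disjoint(2) by (simp add: card_Un_disjoint disjoint_iff)
      then show ?thesis
        unfolding d1_def d3_def using card_EM_at[OF v] card_star_at[OF sub_outside(1) v] by simp
    qed
    finally have "(\<Sum>e\<in>?A. cover_count F e) \<le> 2 * T v + 2 * (d1 v + d3 v)" by simp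
    then have "int (\<Sum>e\<in>?A. cover_count F e) \<le> int (2 * T v + 2 * (d1 v + d3 v))" by (rule of_nat_mono)
    then show ?thesis by (simp only: of_nat_sum of_nat_mult of_nat_add of_nat_numeral)
  qed
  \<comment> \<open>The excess of the edges from \<open>v\<close> to \<open>C2\<close> over its
    other edges; if every edge is covered twice, it is a lower bound for the number
    \<open>T v\<close> of corners at \<open>v\<close>.\<close>
  define P where "P v = max 0 (int (d2 v) - int (d1 v) - int (d3 v))" for v
  have P: "2 * P v \<le> 2 * int (T v) + (\<Sum>e | e \<in> star C2 \<and> v \<in> e. 2 - ?c e)" if v: "v \<in> M" for v
  proof -
    have "(\<Sum>e | e \<in> star C2 \<and> v \<in> e. 2 - ?c e) = 2 * int (d2 v) - (\<Sum>e | e \<in> star C2 \<and> v \<in> e. ?c e)"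
      using card_star_at[OF sub_outside(2) v] by (simp add: sum_subtractf d2_def)
    moreover have "0 \<le> (\<Sum>e | e \<in> star C2 \<and> v \<in> e. 2 - ?c e)"
      using F(3) by (intro sum_nonneg) (simp add: of_nat_le_iff[of _ 2, where 'a = int, simplified])
    ultimately show ?thesis using local[OF v] by (simp add: P_def max_def)
  qed
  \<comment> \<open>Each edge of \<open>star C2\<close> has exactly one end in \<open>M\<close>, so
    its shortfall is counted once.\<close>
  have "(\<Sum>v\<in>M. \<Sum>e | e \<in> star C2 \<and> v \<in> e. 2 - ?c e) = (\<Sum>v\<in>M. \<Sum>e\<in>star C2. if v \<in> e then 2 - ?c e else 0)"
    using fin by (intro sum.cong refl sum.mono_neutral_cong_left) auto
  also have "\<dots> = (\<Sum>e\<in>star C2. \<Sum>v\<in>M. if v \<in> e then 2 - ?c e else 0)" by (rule sum.swap)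
  also have "\<dots> = (\<Sum>e\<in>star C2. 2 - ?c e)"
  proof (rule sum.cong)
    fix e assume "e \<in> star C2"
    moreover have "{v \<in> M. v \<in> e} = e \<inter> M" by blast
    ultimately have "card {v \<in> M. v \<in> e} = 1" using star_Int_M[OF sub_outside(2)] by (simp only:)
    then show "(\<Sum>v\<in>M. if v \<in> e then 2 - ?c e else 0) = 2 - ?c e"
      using finite_M by (simp add: sum.If_cases Int_def)
  qed simp
  also have "\<dots> \<le> (\<Sum>e\<in>EK. 2 - ?c e)"
    using F(3) finEK by (intro sum_mono2) (auto simp: EK_def of_nat_le_iff[of _ 2, where 'a = int, simplified])
  finally have deficit: "(\<Sum>v\<in>M. \<Sum>e | e \<in> star C2 \<and> v \<in> e. 2 - ?c e) \<le> 2 * int (card EK) - (\<Sum>e\<in>EK. ?c e)"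
    by (simp add: sum_subtractf)
  have "(\<Sum>v\<in>M. 2 * P v) \<le> (\<Sum>v\<in>M. 2 * int (T v) + (\<Sum>e | e \<in> star C2 \<and> v \<in> e. 2 - ?c e))"
    by (rule sum_mono) (rule P)
  then have sumP: "2 * (\<Sum>v\<in>M. P v) \<le> 2 * (\<Sum>v\<in>M. int (T v)) + (2 * int (card EK) - (\<Sum>e\<in>EK. ?c e))"
    using deficit by (simp add: sum.distrib sum_distrib_left)
  have cov: "(\<Sum>e\<in>EK. ?c e) \<le> 2 * int (card EK)"
  proof -
    have "(\<Sum>e\<in>EK. ?c e) \<le> (\<Sum>e\<in>EK. 2)" using F(3) by (intro sum_mono) (simp add: of_nat_le_iff[of _ 2, where 'a = int, simplified])
    then show ?thesis by simp
  qed
  have s1: "(\<Sum>v\<in>M. int (d1 v)) = 2 * int (card EM)" "(\<Sum>v\<in>M. int (d3 v)) = 3 * int (card C3)"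
    using sum_d(1,2) by (metis of_nat_sum of_nat_mult of_nat_numeral)+
  have "(\<Sum>v\<in>M. 3 * P v + 6 * int (d1 v) + 4 * int (d3 v) - 24)
      = 3 * (\<Sum>v\<in>M. P v) + 12 * int (card EM) + 12 * int (card C3) - 24 * int (card M)"
    using s1 by (simp add: sum.distrib sum_subtractf sum_distrib_left[symmetric])
  \<comment> \<open>Eliminating the corners and the coverage bounds the sum of \<open>P\<close> by
    \<open>8 * card VK - 4 * card EK - 8\<close>. There \<open>C2\<close> cancels, leaving
    \<open>8 * card M - 4 * card EM - 4 * card C3 - 8\<close>, so the whole sum is at most
    -24.\<close>
  also have "\<dots> < 0" using sumP total F(2) cov cardEK cardVK by simp
  finally have "\<exists>v\<in>M. 3 * P v + 6 * int (d1 v) + 4 * int (d3 v) - 24 < 0"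
    using sum_nonneg[of M "\<lambda>v. 3 * P v + 6 * int (d1 v) + 4 * int (d3 v) - 24"] by (meson not_le)
  then obtain v where v: "v \<in> M" "3 * P v + 6 * int (d1 v) + 4 * int (d3 v) < 24" by auto
  moreover have "P v \<ge> 0" "P v \<ge> int (d2 v) - int (d1 v) - int (d3 v)" by (simp_all add: P_def)
  ultimately have "int (3 * d1 v + 2 * d3 v) < int 12" "int (3 * d1 v + d3 v + 3 * d2 v) < int 24" by simp_all
  then show ?thesis using v(1) unfolding of_nat_less_iff by blast
qed

text \<open>A common neighbour of degree 3 gives two conflicts. One of degree 2 may be replaced by
  the representative with the same neighbourhood, which gives one.\<close>

lemma conflicts_card:
  assumes "v \<in> M"
  shows "card (\<Union>u\<in>{u \<in> V - M. v \<in> N u}. N u - {v}) \<le> 2 * d3 v + d2 v"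
proof -
  let ?A = "{u \<in> C3. v \<in> N u}" and ?B = "{u \<in> C2. v \<in> N u}"
  have sub: "(\<Union>u\<in>{u \<in> V - M. v \<in> N u}. N u - {v}) \<subseteq> (\<Union>u\<in>?A. N u - {v}) \<union> (\<Union>u\<in>?B. N u - {v})"
  proof
    fix x assume "x \<in> (\<Union>u\<in>{u \<in> V - M. v \<in> N u}. N u - {v})"
    then obtain u where u: "u \<in> V - M" "v \<in> N u" "x \<in> N u" "x \<noteq> v" by blast
    have "{v, x} \<subseteq> N u" using u by simp
    then have "card {v, x} \<le> card (N u)" using finite_N by (intro card_mono)
    then have "card (N u) \<ge> 2" using u(4) by simp
    then consider "card (N u) = 2" | "card (N u) = 3" using few[OF u(1)] by linarith
    then show "x \<in> (\<Union>u\<in>?A. N u - {v}) \<union> (\<Union>u\<in>?B. N u - {v})"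
    proof cases
      case 1
      then have "N u \<in> N ` C2" unfolding C2(3) using u(1) by blast
      then obtain u' where "u' \<in> C2" "N u = N u'" by blast
      then have "u' \<in> ?B" "x \<in> N u' - {v}" using u by auto
      then show ?thesis by blast
    next
      case 2
      then have "u \<in> ?A" "x \<in> N u - {v}" using u by (auto simp: C3_def)
      then show ?thesis by blast
    qed
  qed
  have fin: "finite ?A" "finite ?B" using finite_C by auto
  have "card (\<Union>u\<in>{u \<in> V - M. v \<in> N u}. N u - {v}) \<le> card ((\<Union>u\<in>?A. N u - {v}) \<union> (\<Union>u\<in>?B. N u - {v}))"
    using sub fin finite_N by (intro card_mono) auto
  also have "\<dots> \<le> card (\<Union>u\<in>?A. N u - {v}) + card (\<Union>u\<in>?B. N u - {v})" by (rule card_Un_le)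
  also have "\<dots> \<le> (\<Sum>u\<in>?A. card (N u - {v})) + (\<Sum>u\<in>?B. card (N u - {v}))"
    using fin by (intro add_mono card_UN_le)
  also have "(\<Sum>u\<in>?A. card (N u - {v})) = 2 * d3 v" using card_N by (simp add: d3_def)
  also have "(\<Sum>u\<in>?B. card (N u - {v})) = d2 v" using card_N by (simp add: d2_def)
  finally show ?thesis .
qed

end

lemma good_vertex:
  assumes "plane_graph V E p g" "triangle_free E" "M \<subseteq> V" "M \<noteq> {}"
    and few: "\<And>u. u \<in> V - M \<Longrightarrow> card (nbhd E M u) \<le> 3"
  obtains v where "v \<in> M" "card (nbhd E M v) \<le> 3"
    "card (\<Union>u\<in>{u \<in> V - M. v \<in> nbhd E M u}. nbhd E M u - {v}) \<le> 17"
    "card (nbhd E M v) = 3 \<longrightarrow> card (\<Union>u\<in>{u \<in> V - M. v \<in> nbhd E M u}. nbhd E M u - {v}) \<le> 6"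
proof -
  let ?A = "{u \<in> V - M. card (nbhd E M u) = 2}"
  have "nbhd E M ` ?A \<subseteq> nbhd E M ` ?A" ..
  \<comment> \<open>A system of representatives: one vertex for each neighbourhood of size
    2.\<close>
  then obtain C2 where C2: "C2 \<subseteq> ?A" "inj_on (nbhd E M) C2" "nbhd E M ` ?A = nbhd E M ` C2"
    unfolding subset_image_inj by blast
  interpret plane_graph V E p g by fact
  interpret reduced_graph V E p g M C2
    by unfold_locales (rule assms(2-4) C2(1,2) C2(3)[symmetric] few; assumption?)+
  obtain v where v: "v \<in> M" "3 * d1 v + 2 * d3 v < 12" "3 * d1 v + d3 v + 3 * d2 v < 24"
    using discharging by blast
  \<comment> \<open>Over the integers the bounds are 11 and 23. Five times the first plus twice the
    second gives \<open>21 * d1 v + 12 * d3 v + 6 * d2 v \<le> 101\<close>, hence at most 38 for the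
    last two terms if \<open>d1 v = 3\<close>.\<close>
  then have d: "d1 v \<le> 3" "2 * d3 v + d2 v \<le> 17" "d1 v = 3 \<Longrightarrow> 2 * d3 v + d2 v \<le> 6" by linarith+
  let ?X = "\<Union>u\<in>{u \<in> V - M. v \<in> N u}. N u - {v}"
  have "card ?X \<le> 2 * d3 v + d2 v" by (rule conflicts_card[OF v(1)])
  then have "d1 v \<le> 3" "card ?X \<le> 17" "d1 v = 3 \<longrightarrow> card ?X \<le> 6" using d by auto
  then show ?thesis unfolding d1_def by (rule that[OF v(1)])
qed

section \<open>The inversion\<close>

lemma card_matching_ge:
  assumes "X \<subseteq> triples" "card X \<le> 3"
  shows "card (matching X b) \<ge> (if card X = 3 then 7 else 24)"
proof -
  have "finite X" using assms(1) finite_triples by (rule finite_subset)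
  then consider "X = {}" | "card X = 1" | "card X = 2" | "card X = 3" using assms(2) by (cases "card X") fastforce+
  then show ?thesis
  proof cases
    case 2
    then obtain A where "X = {A}" by (auto simp: card_1_singleton_iff)
    then show ?thesis using card_matching_1[of A b] assms(1) by simp
  next
    case 3
    then obtain A B where "X = {A, B}" "A \<noteq> B" by (auto simp: card_2_iff)
    then show ?thesis using card_matching_2[of A B b] assms(1) by simp
  next
    case 4
    then obtain A B C where "X = {A, B, C}" "A \<noteq> B" "A \<noteq> C" "B \<noteq> C" by (auto simp: card_3_iff)
    then show ?thesis using card_matching_3[of A B C b] assms(1) 4 by simp
  qed (simp add: card_matching_0)
qed

text \<open>The vertex \<open>v\<close> of \<open>good_vertex\<close> is coloured after
  \<open>M - {v}\<close>. With respect to \<open>M - {v}\<close> it counts as eliminated, so the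
  induction hypothesis gives its neighbours distinct vectors and its equations are solvable. The
  vector must also differ from those of its conflicts, to restore injectivity around the eliminated
  vertices.\<close>

lemma layered_coloring:
  assumes plane: "plane_graph V E p g" and "triangle_free E" "M \<subseteq> V"
    and "\<And>u. u \<in> V - M \<Longrightarrow> card (nbhd E M u) \<le> 3"
  shows "\<exists>f. (\<forall>u\<in>M. f u \<in> triples) \<and>
    (\<forall>u\<in>M. \<forall>w\<in>M. {u, w} \<in> E \<longrightarrow> odd (card (f u \<inter> f w)) = c {u, w}) \<and>
    (\<forall>u\<in>V - M. inj_on f (nbhd E M u))"
  using assms(3,4)
proof (induction "card M" arbitrary: M)
  case 0
  then have "M = {}" using finite_subset[OF 0(2) plane_graph.finite_V[OF plane]] by simp
  then show ?case by (simp add: nbhd_def)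
next
  case (Suc n)
  interpret plane_graph V E p g by (rule plane)
  have finM: "finite M" using Suc.prems(1) finite_V by (rule finite_subset)
  have ne: "M \<noteq> {}" using Suc.hyps(2) by auto
  obtain v where v: "v \<in> M" "card (nbhd E M v) \<le> 3"
    and conf: "card (\<Union>u\<in>{u \<in> V - M. v \<in> nbhd E M u}. nbhd E M u - {v}) \<le> 17"
      "card (nbhd E M v) = 3 \<longrightarrow> card (\<Union>u\<in>{u \<in> V - M. v \<in> nbhd E M u}. nbhd E M u - {v}) \<le> 6"
    by (rule good_vertex[OF plane assms(2) Suc.prems(1) ne Suc.prems(2)])
  define X where "X = (\<Union>u\<in>{u \<in> V - M. v \<in> nbhd E M u}. nbhd E M u - {v})"
  define M' where "M' = M - {v}"
  have no_loop: "{x, x} \<notin> E" for x using card_edge[of "{x, x}"] by auto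
  have nb: "nbhd E M' u = nbhd E M u - {v}" for u by (auto simp: nbhd_def M'_def)
  have nbv: "nbhd E M' v = nbhd E M v" using no_loop[of v] by (auto simp: nbhd_def M'_def)
  have fin: "finite (nbhd E M u)" for u using finM by (simp add: nbhd_def)
  have "n = card M'" using Suc.hyps(2) v(1) finM by (simp add: M'_def)
  moreover have "M' \<subseteq> V" using Suc.prems(1) by (auto simp: M'_def)
  moreover have "card (nbhd E M' u) \<le> 3" if u: "u \<in> V - M'" for u
  proof (cases "u = v")
    case True
    then show ?thesis using v(2) nbv by simp
  next
    case False
    then have "card (nbhd E M u) \<le> 3" using u Suc.prems(2) by (simp add: M'_def)
    moreover have "card (nbhd E M' u) \<le> card (nbhd E M u)" unfolding nb using fin by (intro card_mono) auto
    ultimately show ?thesis by simp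
  qed
  ultimately obtain f where f: "\<And>u. u \<in> M' \<Longrightarrow> f u \<in> triples"
    "\<And>u w. u \<in> M' \<Longrightarrow> w \<in> M' \<Longrightarrow> {u, w} \<in> E \<Longrightarrow> odd (card (f u \<inter> f w)) = c {u, w}"
    "\<And>u. u \<in> V - M' \<Longrightarrow> inj_on f (nbhd E M' u)"
    using Suc.hyps(1)[of M'] by blast
  let ?N = "nbhd E M v"
  define b where "b A = c {v, inv_into ?N f A}" for A
  have injN: "inj_on f ?N" using f(3)[of v] nbv v(1) Suc.prems(1) by (auto simp: M'_def)
  have bf: "b (f w) = c {v, w}" if "w \<in> ?N" for w using that injN by (simp add: b_def)
  have "?N \<subseteq> M'" using nbv by (auto simp: nbhd_def)
  then have "f ` ?N \<subseteq> triples" using f(1) by blast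
  then have "card (matching (f ` ?N) b) \<ge> (if card ?N = 3 then 7 else 24)"
    using card_matching_ge[of "f ` ?N" b] v(2) card_image[OF injN] by simp
  moreover have finX: "finite X" unfolding X_def using finite_V fin by simp
  moreover have "card (f ` X) \<le> card X" using finX by (rule card_image_le)
  \<comment> \<open>6 < 7 for three neighbours and 17 < 24 for fewer.\<close>
  ultimately have "card (f ` X) < card (matching (f ` ?N) b)"
    using conf unfolding X_def by (auto split: if_splits)
  then have "\<not> matching (f ` ?N) b \<subseteq> f ` X" using card_mono[of "f ` X"] finX by (meson finite_imageI not_le)
  then obtain t where t: "t \<in> matching (f ` ?N) b" "t \<notin> f ` X" by blast
  then have tt: "t \<in> triples" and tm: "\<And>w. w \<in> ?N \<Longrightarrow> odd (card (t \<inter> f w)) = c {v, w}"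
    using bf by (auto simp: matching_def)
  let ?f = "f(v := t)"
  show ?case
  proof (intro exI[of _ ?f] conjI ballI impI)
    fix u assume "u \<in> M"
    then show "?f u \<in> triples" using tt f(1)[of u] by (simp add: M'_def)
  next
    fix u w assume uw: "u \<in> M" "w \<in> M" "{u, w} \<in> E"
    then have "u \<noteq> w" using no_loop by auto
    then consider "u = v" "w \<in> ?N" "w \<noteq> v" | "w = v" "u \<in> ?N" "u \<noteq> v" | "u \<in> M'" "w \<in> M'"
      using uw by (auto simp: nbhd_def M'_def insert_commute)
    then show "odd (card (?f u \<inter> ?f w)) = c {u, w}"
    proof cases
      case 1
      then show ?thesis using tm[of w] by simp
    next
      case 2
      then show ?thesis using tm[of u] by (simp add: Int_commute insert_commute)
    next
      case 3
      then show ?thesis using f(2)[OF 3 uw(3)] by (simp add: M'_def)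
    qed
  next
    fix u assume u: "u \<in> V - M"
    then have "inj_on f (nbhd E M u - {v})" using f(3)[of u] nb by (simp add: M'_def)
    then have inj: "inj_on ?f (nbhd E M u - {v})" by (auto simp: inj_on_def)
    show "inj_on ?f (nbhd E M u)"
    proof (cases "v \<in> nbhd E M u")
      case True
      then have "nbhd E M u - {v} \<subseteq> X" using u unfolding X_def by blast
      then have "?f v \<notin> ?f ` (nbhd E M u - {v})" using t(2) by auto
      then have "inj_on ?f (insert v (nbhd E M u - {v}))" using inj unfolding inj_on_insert by simp
      then show ?thesis using True by (simp add: insert_absorb)
    qed (use inj in simp)
  qed
qed

section \<open>From triples to vectors over the field with two elements\<close>

definition incidence_vec :: "nat set \<Rightarrow> bit vec" where
  "incidence_vec c = vec 10 (\<lambda>i. of_bool (i \<in> c))"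

lemma incidence_vec_binom: "c \<in> triples \<Longrightarrow> incidence_vec c \<in> binom_vectors 10 3"
proof -
  assume c: "c \<in> triples"
  have "{i. i < 10 \<and> vec_index (incidence_vec c) i \<noteq> 0} = c"
    using c by (auto simp: incidence_vec_def triples_def)
  then show ?thesis using c by (simp add: binom_vectors_def triples_def incidence_vec_def)
qed

lemma of_nat_bit: "(of_nat n :: bit) = of_bool (odd n)"
  by (induction n) auto

lemma scalar_prod_incidence_vec:
  assumes "A \<in> triples"
  shows "scalar_prod (incidence_vec A) (incidence_vec B) = of_bool (odd (card (A \<inter> B)))"
proof -
  have "scalar_prod (incidence_vec A) (incidence_vec B) = (\<Sum>i\<in>{0..<10::nat}. of_bool (i \<in> A) * of_bool (i \<in> B))"
    by (simp add: scalar_prod_def incidence_vec_def)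
  also have "\<dots> = (\<Sum>i\<in>{0..<10::nat}. of_bool (i \<in> A \<inter> B))" by (intro sum.cong) auto
  also have "\<dots> = of_nat (card ({0..<10::nat} \<inter> {i. i \<in> A \<inter> B}))" by (rule sum_of_bool_eq[OF finite_atLeastLessThan finite_atLeastLessThan])
  also have "{0..<10} \<inter> {i. i \<in> A \<inter> B} = A \<inter> B" using assms by (auto simp: triples_def)
  finally show ?thesis by (simp add: of_nat_bit)
qed

theorem theorem4p6:
  fixes V :: "'a set" and E :: "'a set set" and \<pi> :: "'a set \<Rightarrow> bit"
  assumes "simple_graph V E"
    and "triangle_free E"
    and "planar_graph V E"
  shows "\<exists>f. is_binom_inversion 10 3 V E \<pi> f"
proof -
  obtain p g where "plane_drawing V E p g" using assms(3) by (auto simp: planar_graph_def)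
  then interpret plane_graph V E p g using assms(1) by unfold_locales
  obtain f where f: "\<forall>u\<in>V. f u \<in> triples"
    "\<forall>u\<in>V. \<forall>w\<in>V. {u, w} \<in> E \<longrightarrow> odd (card (f u \<inter> f w)) = (\<pi> {u, w} = 1)"
    \<comment> \<open>With \<open>M = V\<close> no vertex is eliminated yet, so the degree
      hypothesis is vacuous.\<close>
    using layered_coloring[OF plane_graph_axioms assms(2) order_refl, of "\<lambda>e. \<pi> e = 1"] by auto
  have "\<pi> {u, w} = scalar_prod (incidence_vec (f u)) (incidence_vec (f w))" if e: "{u, w} \<in> E" for u w
  proof -
    have "u \<in> V" "w \<in> V" using edge_subset[OF e] by auto
    then show ?thesis using f e by (cases "\<pi> {u, w} = 1") (auto simp: scalar_prod_incidence_vec)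
  qed
  then have "is_binom_inversion 10 3 V E \<pi> (\<lambda>u. incidence_vec (f u))"
    using f(1) incidence_vec_binom by (auto simp: is_binom_inversion_def is_inversion_def binom_vectors_def)
  then show ?thesis by blast
qed

end
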